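(* Let $S=\begin{pmatrix}A&B\\ C&D\end{pmatrix}$ be a non-commuting switch with entries in a generalized quaternion algebra $\mathcal{Q}$. Then for every virtual link diagram $\mathcal{D}$ representing a classical knot or link, the invariant $\Delta_0=d(M)$ of the presentation matrix $M$ associated with $\mathcal{D}$ and $S$ is zero.
   Context: $\mathcal{Q}=\left(\frac{\lambda,\ \mu}{F}\right)$ is the $4$-dimensional associative algebra over a field $F$ of characteristic $\neq 2$ with basis $1,i,j,k$ and relations $i^2=\lambda,\ j^2=\mu,\ ij=-ji=k$ ($\lambda,\mu\in F$ nonzero). A non-commuting switch is a matrix $S=\begin{pmatrix}A&B\\ C&D\end{pmatrix}$ where $A,B\in\mathcal{Q}$ are such that $A$, $A-1$, $B$ are invertible, $AB\neq BA$, $A^{-1}B^{-1}AB-BA^{-1}B^{-1}A=B^{-1}AB-A$, and $C=A^{-1}B^{-1}A(1-A)$, $D=1-A^{-1}B^{-1}AB$. Determinant: let $\overline{F}$ be an algebraic closure of $F$; embed $\mathcal{Q}$ in $M_2(\overline{F})$ by $i\mapsto\begin{pmatrix}0&\sqrt{-\lambda}\\-\sqrt{-\lambda}&0\end{pmatrix}$, $j\mapsto\begin{pmatrix}0&\sqrt{\mu}\\ \sqrt{\mu}&0\end{pmatrix}$, $k\mapsto\begin{pmatrix}\sqrt{-\lambda\mu}&0\\0&-\sqrt{-\lambda\mu}\end{pmatrix}$ (with $\sqrt{-\lambda\mu}=\sqrt{-\lambda}\sqrt{\mu}$), hence $M_n(\mathcal{Q})\subset M_{2n}(\overline{F})$,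 and let $d:M_n(\mathcal{Q})\to\overline{F}$ be this embedding followed by the ordinary determinant. Virtual link diagrams: oriented immersed circles in the plane whose double points are either classical crossings (with over/under information, positive or negative) or virtual crossings; two diagrams are equivalent if related by the classical Reidemeister moves, the flat Reidemeister moves among virtual crossings, and the mixed move (an arc through two consecutive virtual crossings may be moved across a classical crossing). A classical knot or link is a class containing a diagram without virtual crossings. Presentation matrix: the semi-arcs of a diagram with $n$ classical crossings are the $2n$ pieces obtained by cutting at classical crossings only (virtual crossings are passed through). Assign a generator to each semi-arc. At each classical crossing, drawn so that both strands are oriented from west to east: if the crossing is positive let $a$ be the label at SW (under-strand input), $b$ at NW (over-strand input), $c$ at SE (over-strand output), $d$ at NE (under-strand output); if it is negative let $a$ be the label at SE, $b$ at NE, $c$ at SW, $d$ at NW. In both cases impose the two relations $c=Aa+Bb$, $d=Ca+Db$. Writing all $2n$ relations as $M\mathbf{x}=\mathbf{0}$, with $\mathbf{x}$ the vector of generators, gives the $2n\times 2n$ presentation matrix $M$ over $\mathcal{Q}$, and $\Delta_0=d(M)$. *)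

theory Defs
  imports "HOL-Algebra.Algebraic_Closure_Type" "Jordan_Normal_Form.Determinant"
begin

section \<open>Generalized quaternion algebras (lam, mu / F)\<close>

text \<open>Element a0 + a1 i + a2 j + a3 k with i^2 = lam, j^2 = mu, ij = -ji = k.\<close>
datatype 'a quat = Quat 'a 'a 'a 'a

definition qzero :: "'a::field quat" where "qzero = Quat 0 0 0 0"
definition qone :: "'a::field quat" where "qone = Quat 1 0 0 0"

fun qadd :: "'a::field quat \<Rightarrow> 'a quat \<Rightarrow> 'a quat" where
  "qadd (Quat a0 a1 a2 a3) (Quat b0 b1 b2 b3) = Quat (a0+b0) (a1+b1) (a2+b2) (a3+b3)"

fun qneg :: "'a::field quat \<Rightarrow> 'a quat" where
  "qneg (Quat a0 a1 a2 a3) = Quat (-a0) (-a1) (-a2) (-a3)"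

definition qsub :: "'a::field quat \<Rightarrow> 'a quat \<Rightarrow> 'a quat" where
  "qsub x y = qadd x (qneg y)"

fun qmul :: "'a::field \<Rightarrow> 'a \<Rightarrow> 'a quat \<Rightarrow> 'a quat \<Rightarrow> 'a quat" where
  "qmul lam mu (Quat a0 a1 a2 a3) (Quat b0 b1 b2 b3) =
     Quat (a0*b0 + lam*a1*b1 + mu*a2*b2 - lam*mu*a3*b3)
          (a0*b1 + a1*b0 - mu*a2*b3 + mu*a3*b2)
          (a0*b2 + a2*b0 + lam*a1*b3 - lam*a3*b1)
          (a0*b3 + a3*b0 + a1*b2 - a2*b1)"

definition qinvertible :: "'a::field \<Rightarrow> 'a \<Rightarrow> 'a quat \<Rightarrow> bool" where
  "qinvertible lam mu x \<longleftrightarrow> (\<exists>y. qmul lam mu x y = qone \<and> qmul lam mu y x = qone)"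

definition qinv :: "'a::field \<Rightarrow> 'a \<Rightarrow> 'a quat \<Rightarrow> 'a quat" where
  "qinv lam mu x = (SOME y. qmul lam mu x y = qone \<and> qmul lam mu y x = qone)"

text \<open>Non-commuting switch S = (A B; C D) over the quaternion algebra.\<close>
definition nc_switch :: "'a::field \<Rightarrow> 'a \<Rightarrow> 'a quat \<Rightarrow> 'a quat \<Rightarrow> 'a quat \<Rightarrow> 'a quat \<Rightarrow> bool" where
  "nc_switch lam mu A B C D \<longleftrightarrow>
     (let m = qmul lam mu; Ai = qinv lam mu A; Bi = qinv lam mu B in
       qinvertible lam mu A \<and> qinvertible lam mu (qsub A qone) \<and> qinvertible lam mu B \<and>
       m A B \<noteq> m B A \<and>
       qsub (m (m (m Ai Bi) A) B) (m (m (m B Ai) Bi) A) = qsub (m (m Bi A) B) A \<and>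
       C = m (m (m Ai Bi) A) (qsub qone A) \<and>
       D = qsub qone (m (m (m Ai Bi) A) B))"

section \<open>The determinant d via the embedding into M_2 of the algebraic closure\<close>

definition sqrt_ac :: "'a::field alg_closure \<Rightarrow> 'a alg_closure" where
  "sqrt_ac x = (SOME r. r ^ 2 = x)"

text \<open>Image of a quaternion: i |-> (0 s; -s 0), j |-> (0 t; t 0), k |-> (st 0; 0 -st),
  with s = sqrt(-lam), t = sqrt(mu).\<close>
fun qemb :: "'a::field \<Rightarrow> 'a \<Rightarrow> 'a quat \<Rightarrow> nat \<Rightarrow> nat \<Rightarrow> 'a alg_closure" where
  "qemb lam mu (Quat a0 a1 a2 a3) r c =
    (let s = sqrt_ac (- to_ac lam); t = sqrt_ac (to_ac mu) in
     if r = 0 \<and> c = 0 then to_ac a0 + to_ac a3 * (s * t)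
     else if r = 0 then to_ac a1 * s + to_ac a2 * t
     else if c = 0 then - (to_ac a1 * s) + to_ac a2 * t
     else to_ac a0 - to_ac a3 * (s * t))"

text \<open>d of an m x m quaternion matrix M (given as a function on indices < m).\<close>
definition qdet :: "'a::field \<Rightarrow> 'a \<Rightarrow> nat \<Rightarrow> (nat \<Rightarrow> nat \<Rightarrow> 'a quat) \<Rightarrow> 'a alg_closure" where
  "qdet lam mu m M =
     det (mat (2*m) (2*m) (\<lambda>(r, c). qemb lam mu (M (r div 2) (c div 2)) (r mod 2) (c mod 2)))"

section \<open>Virtual link diagrams as (signed) Gauss diagrams\<close>

text \<open>An entry (x, ov) records a passage of a strand through classical crossing x,
  over (ov = True) or under (ov = False). A diagram is a list of oriented circles
  (each a cyclic list of passages; [] is a crossingless circle) together with the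
  signs of the crossings (True = positive). Virtual crossings are invisible.\<close>
type_synonym gentry = "nat \<times> bool"
type_synonym gdiag = "gentry list list \<times> (nat \<Rightarrow> bool)"

definition gd_crossings :: "gentry list list \<Rightarrow> nat set" where
  "gd_crossings L = fst ` set (concat L)"

definition gd_wf :: "gdiag \<Rightarrow> bool" where
  "gd_wf D \<longleftrightarrow> (\<forall>x. count_list (concat (fst D)) (x, True) \<le> 1 \<and>
                    count_list (concat (fst D)) (x, False) = count_list (concat (fst D)) (x, True))"

definition gd_succ :: "gentry list list \<Rightarrow> gentry \<Rightarrow> gentry" where
  "gd_succ L e = (THE e'. \<exists>xs\<in>set L. \<exists>i<length xs. xs ! i = e \<and> e' = xs ! (Suc i mod length xs))"

definition gd_pred :: "gentry list list \<Rightarrow> gentry \<Rightarrow> gentry" where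
  "gd_pred L e = (THE e'. \<exists>xs\<in>set L. \<exists>i<length xs. xs ! i = e \<and>
                     e' = xs ! ((i + length xs - 1) mod length xs))"

subsection \<open>Classical (= realizable without virtual crossings) diagrams\<close>

text \<open>Half-edges (darts) (x, ov, out) at crossing x. Counterclockwise rotation at a crossing
  drawn west-to-east: positive: under-in, over-out, under-out, over-in;
  negative: under-in, over-in, under-out, over-out.\<close>
definition gd_rot :: "(nat \<Rightarrow> bool) \<Rightarrow> nat \<times> bool \<times> bool \<Rightarrow> nat \<times> bool \<times> bool" where
  "gd_rot s d = (case d of (x, ov, out) \<Rightarrow>
     if s x then (if \<not> ov \<and> \<not> out then (x, True, True) else if ov \<and> out then (x, False, True)
                  else if \<not> ov \<and> out then (x, True, False) else (x, False, False))
     else (if \<not> ov \<and> \<not> out then (x, True, False) else if ov \<and> \<not> out then (x, False, True)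
           else if \<not> ov \<and> out then (x, True, True) else (x, False, False)))"

definition gd_alpha :: "gentry list list \<Rightarrow> nat \<times> bool \<times> bool \<Rightarrow> nat \<times> bool \<times> bool" where
  "gd_alpha L d = (case d of (x, ov, out) \<Rightarrow>
     if out then (fst (gd_succ L (x, ov)), snd (gd_succ L (x, ov)), False)
     else (fst (gd_pred L (x, ov)), snd (gd_pred L (x, ov)), True))"

definition gd_darts :: "gentry list list \<Rightarrow> (nat \<times> bool \<times> bool) set" where
  "gd_darts L = {(x, ov, out). x \<in> gd_crossings L}"

definition gd_num_faces :: "gdiag \<Rightarrow> nat" where
  "gd_num_faces D = card ((\<lambda>d. {d'. \<exists>k. ((gd_rot (snd D) \<circ> gd_alpha (fst D)) ^^ k) d = d'})
                            ` gd_darts (fst D))"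

definition gd_num_components :: "gdiag \<Rightarrow> nat" where
  "gd_num_components D = card (gd_darts (fst D) //
      ({(d, d'). d \<in> gd_darts (fst D) \<and> (d' = gd_rot (snd D) d \<or> d' = gd_alpha (fst D) d)}\<^sup>*))"

text \<open>Classical: the underlying 4-valent graph with the rotation system given by the crossings
  embeds in the sphere (Euler: V - E + F = 2 * components, V = #crossings, E = 2 V).\<close>
definition gd_classical :: "gdiag \<Rightarrow> bool" where
  "gd_classical D \<longleftrightarrow> gd_wf D \<and>
     gd_num_faces D = card (gd_crossings (fst D)) + 2 * gd_num_components D"

subsection \<open>Reidemeister moves and equivalence\<close>

fun gd_fill :: "(nat \<Rightarrow> gentry list) \<Rightarrow> (gentry + nat) list list \<Rightarrow> gentry list list" where
  "gd_fill W C = map (\<lambda>cs. concat (map (\<lambda>z. case z of Inl e \<Rightarrow> [e] | Inr i \<Rightarrow> W i) cs)) C"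

definition reid_pattern :: "nat \<Rightarrow> (nat \<Rightarrow> gentry list) \<Rightarrow> (nat \<Rightarrow> gentry list)
                              \<Rightarrow> (nat \<Rightarrow> bool) \<Rightarrow> (nat \<Rightarrow> bool) \<Rightarrow> bool" where
  "reid_pattern h W W' s s' \<longleftrightarrow>
    (h = 1 \<and> W 0 = [] \<and> (\<exists>x ov. W' 0 = [(x, ov), (x, \<not> ov)])) \<or>
    (h = 2 \<and> W 0 = [] \<and> W 1 = [] \<and>
       (\<exists>x y. x \<noteq> y \<and> W' 0 = [(x, True), (y, True)] \<and>
          (W' 1 = [(x, False), (y, False)] \<or> W' 1 = [(y, False), (x, False)]) \<and> s' x \<noteq> s' y)) \<or>
    (h = 3 \<and> (\<exists>x y z t m b or. distinct [x, y, z] \<and>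
       W 0 = (if t then [(x, True), (y, True)] else [(y, True), (x, True)]) \<and>
       W 1 = (if m then [(x, False), (z, True)] else [(z, True), (x, False)]) \<and>
       W 2 = (if b then [(y, False), (z, False)] else [(z, False), (y, False)]) \<and>
       (\<forall>i<3. W' i = rev (W i)) \<and>
       s x = s' x \<and> s y = s' y \<and> s z = s' z \<and>
       s x = (t = (m = or)) \<and> s y = (t = (b = or)) \<and> s z = (m = (b = or))))"

definition reid_move :: "gdiag \<Rightarrow> gdiag \<Rightarrow> bool" where
  "reid_move D D' \<longleftrightarrow> (\<exists>C W W' h.
     (\<forall>i<h. count_list (concat C) (Inr i) = 1) \<and>
     (\<forall>i. Inr i \<in> set (concat C) \<longrightarrow> i < h) \<and>
     (\<forall>i<h. \<forall>e\<in>set (W i @ W' i). \<forall>ov. Inl (fst e, ov) \<notin> set (concat C)) \<and>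
     fst D = gd_fill W C \<and> fst D' = gd_fill W' C \<and>
     (\<forall>x ov. Inl (x, ov) \<in> set (concat C) \<longrightarrow> snd D x = snd D' x) \<and>
     reid_pattern h W W' (snd D) (snd D'))"

definition gd_same :: "gdiag \<Rightarrow> gdiag \<Rightarrow> bool" where
  "gd_same D D' \<longleftrightarrow>
     (\<exists>f. inj_on f (gd_crossings (fst D)) \<and> fst D' = map (map (\<lambda>(x, ov). (f x, ov))) (fst D) \<and>
          (\<forall>x\<in>gd_crossings (fst D). snd D' (f x) = snd D x)) \<or>
     ((\<forall>x\<in>gd_crossings (fst D). snd D' x = snd D x) \<and>
       ((\<exists>i<length (fst D). fst D' = (fst D)[i := rotate1 (fst D ! i)]) \<or>
        mset (fst D') = mset (fst D)))"

definition gd_step :: "gdiag \<Rightarrow> gdiag \<Rightarrow> bool" where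
  "gd_step D D' \<longleftrightarrow> gd_wf D \<and> gd_wf D' \<and> (gd_same D D' \<or> reid_move D D')"

definition gd_equiv :: "gdiag \<Rightarrow> gdiag \<Rightarrow> bool" where
  "gd_equiv = (\<lambda>D D'. gd_step D D' \<or> gd_step D' D)\<^sup>*\<^sup>*"

definition represents_classical_link :: "gdiag \<Rightarrow> bool" where
  "represents_classical_link D \<longleftrightarrow> (\<exists>D0. gd_classical D0 \<and> gd_equiv D D0)"

section \<open>Presentation matrix and Delta_0\<close>

text \<open>Semi-arcs are indexed by the passage they start from: 2x (under) / 2x+1 (over).\<close>
definition semiarc :: "gentry \<Rightarrow> nat" where
  "semiarc e = 2 * fst e + (if snd e then 1 else 0)"

text \<open>Labels (a, b, c, d) at crossing x.\<close>
definition xlabels :: "gdiag \<Rightarrow> nat \<Rightarrow> nat \<times> nat \<times> nat \<times> nat" where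
  "xlabels D x =
    (if snd D x
     then (semiarc (gd_pred (fst D) (x, False)), semiarc (gd_pred (fst D) (x, True)),
           semiarc (x, True), semiarc (x, False))
     else (semiarc (x, False), semiarc (x, True),
           semiarc (gd_pred (fst D) (x, True)), semiarc (gd_pred (fst D) (x, False))))"

definition qind :: "bool \<Rightarrow> 'a::field quat \<Rightarrow> 'a quat" where
  "qind P q = (if P then q else qzero)"

text \<open>Row 2x: c - A a - B b = 0; row 2x+1: d - C a - D b = 0.\<close>
definition pres_matrix :: "'a::field quat \<Rightarrow> 'a quat \<Rightarrow> 'a quat \<Rightarrow> 'a quat \<Rightarrow> gdiag
                             \<Rightarrow> nat \<Rightarrow> nat \<Rightarrow> 'a quat" where
  "pres_matrix A B C D Dg r j =
    (case xlabels Dg (r div 2) of (a, b, c, d) \<Rightarrow>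
      if r mod 2 = 0
      then qsub (qsub (qind (j = c) qone) (qind (j = a) A)) (qind (j = b) B)
      else qsub (qsub (qind (j = d) qone) (qind (j = a) C)) (qind (j = b) D))"

definition Delta0 :: "'a::field \<Rightarrow> 'a \<Rightarrow> 'a quat \<Rightarrow> 'a quat \<Rightarrow> 'a quat \<Rightarrow> 'a quat
                        \<Rightarrow> nat \<Rightarrow> gdiag \<Rightarrow> 'a alg_closure" where
  "Delta0 lam mu A B C D n Dg = qdet lam mu (2 * n) (pres_matrix A B C D Dg)"

end

theory Submission
  imports Defs Complex_Main
begin

text \<open>
  A non-commuting switch makes any module over the quaternions a biquandle: the map
  $(a, b) \<mapsto> (Aa + Bb, Ca + Db)$ satisfies the Yang--Baxter equation and is invertible, also sideways.
  Hence the existence of a nonzero labelling of the semi-arcs by quaternions that satisfies the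
  crossing relations is invariant under the Reidemeister moves. A planar diagram has such a labelling:
  the unit $T = B^{-1}(1 - A)$ satisfies $S(v, Tv) = (v, Tv)$, so a semi-arc with Alexander number $k$ may
  be labelled $T^k v$. Alexander numbers exist on the sphere because
  every cycle is a boundary there, which is derived from Euler's formula by comparing
  dimensions: face boundaries and vertex coboundaries are orthogonal and together span the edge space.
  Finally a nonzero labelling yields a nonzero kernel vector of the embedded presentation matrix.
\<close>

section \<open>Switches\<close>

text \<open>Determinants are never compared across moves: a move can change the size of the matrix,
  and block reductions would take place over a noncommutative ring. Nonzero solvability passes
  through a move directly, and a nonzero solution is enough for a vanishing determinant. The moves
  are therefore studied on an abstract set with two operations and a marked point \<open>z\<close>
  in the role of 0. Two obstacles shape the bookkeeping. Diagrams along the way may contain circles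
  without crossings, which have no passage to carry a label. And a labelling must not be nonzero
  only on semi-arcs that a move deletes, so each move also needs the fact that zero boundary labels
  force zero inner labels. \<open>yb1\<close> to \<open>yb3\<close> are the three coordinates of
  \<open>(S x 1)(1 x S)(S x 1) = (1 x S)(S x 1)(1 x S)\<close>. The conditions on \<open>f\<close>
  or \<open>g\<close> alone are sideways invertibility, which serves strands of opposite directions;
  \<open>fix_iff\<close> serves kinks.\<close>

locale switch =
  fixes f g :: "'v \<Rightarrow> 'v \<Rightarrow> 'v" and z :: 'v
  assumes nontrivial: "\<exists>v. v \<noteq> z"
    and f_zero: "f z z = z" and g_zero: "g z z = z"
    and inj: "\<lbrakk>f a b = f a' b'; g a b = g a' b'\<rbrakk> \<Longrightarrow> a = a' \<and> b = b'"
    and surj: "\<exists>a b. f a b = c \<and> g a b = d"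
    and f_inj: "f a b = f a b' \<Longrightarrow> b = b'" and f_surj: "\<exists>b. f a b = c"
    and g_inj: "g a b = g a' b \<Longrightarrow> a = a'" and g_surj: "\<exists>a. g a b = d"
    and fix_iff: "f a b = a \<longleftrightarrow> g a b = b"
    and yb1: "f (f a b) (f (g a b) c) = f a (f b c)"
    and yb2: "g (f a b) (f (g a b) c) = f (g a (f b c)) (g b c)"
    and yb3: "g (g a b) c = g (g a (f b c)) (g b c)"

lemma (in ring_1) unit_left_cancel:
  assumes "c' * c = 1" shows "c * x = c * y \<longleftrightarrow> x = y"
  using assms by (metis mult.assoc mult_1_left)

text \<open>With the unit \<open>W = Ai * Bi * A\<close> the switch reads
  \<open>C = W (1 - A)\<close>, \<open>D = 1 - W B\<close>, and the fundamental equation becomes one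
  commutation rule, \<open>BW\<close>, which serves as a rewrite rule for everything below.\<close>

lemma (in ring_1) nc_switch_switch:
  assumes A: "A * Ai = 1" "Ai * A = 1" and A1: "(A - 1) * Ui = 1" "Ui * (A - 1) = 1"
    and B: "B * Bi = 1" "Bi * B = 1"
    and fund: "Ai * Bi * A * B - B * Ai * Bi * A = Bi * A * B - A"
    and C: "C = Ai * Bi * A * (1 - A)" and D: "D = 1 - Ai * Bi * A * B"
  shows "switch (\<lambda>a b. A * a + B * b) (\<lambda>a b. C * a + D * b) 0"
proof -
  define W where "W = Ai * Bi * A"
  define Wi where "Wi = Ai * B * A"
  define Y where "Y = Bi * A * B"
  have A': "A * (Ai * x) = x" "Ai * (A * x) = x" for x
    using A by (simp_all add: mult.assoc[symmetric])
  have B': "B * (Bi * x) = x" "Bi * (B * x) = x" for x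
    using B by (simp_all add: mult.assoc[symmetric])
  have W: "W * Wi = 1" "Wi * W = 1"
    by (simp_all add: W_def Wi_def mult.assoc A A' B B')
  have C': "C = W * (1 - A)" and D': "D = 1 - W * B"
    using C D by (simp_all add: W_def)
  have AWB: "A * (W * B) = Y" "A * (W * (B * x)) = Y * x" for x
    by (simp_all add: W_def Y_def mult.assoc A')
  have BAW: "B * (A * W) = A" "B * (A * (W * x)) = A * x" for x
    by (simp_all add: W_def mult.assoc A' B')
  have BY: "B * Y = A * B" "B * (Y * x) = A * (B * x)" for x
    by (simp_all add: Y_def mult.assoc B')
  have BW: "B * W = W * B - Y + A"
    using fund by (simp add: W_def Y_def mult.assoc algebra_simps)
  then have BW': "B * (W * x) = W * (B * x) - Y * x + A * x" for x
    by (simp add: mult.assoc[symmetric] distrib_right left_diff_distrib)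
  note rules = C' D' AWB BAW BY BW BW' algebra_simps
  \<comment> \<open>Coefficients of a, b, c in the three Yang-Baxter coordinates. Of the nine
    identities two are trivial; \<open>e1\<close>, \<open>e2\<close> belong to the first coordinate,
    \<open>e3\<close> to \<open>e5\<close> to the second, \<open>e6\<close>, \<open>e7\<close> to
    the third.\<close>
  have e1: "A = A * A + B * A * C" by (simp add: rules)
  have e2: "B * A = A * B + B * A * D" by (simp add: rules)
  have e3: "A * C = C * A + D * A * C" by (simp add: rules)
  have e4: "C * B + D * A * D = A * D * A + B * C" by (simp add: rules)
  have e5: "D * B = A * D * B + B * D" by (simp add: rules)
  have e6: "C * D = C * D * A + D * C" by (simp add: rules)
  have e7: "D = C * D * B + D * D" by (simp add: rules)
  have U: "(1 - A) * - Ui = 1" "- Ui * (1 - A) = 1"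
    using A1 by (simp_all add: algebra_simps)
  then have U': "(1 - A) * (- Ui * x) = x" "- Ui * ((1 - A) * x) = x" for x
    by (metis mult.assoc mult_1_left)+
  define Ci where "Ci = - Ui * Wi"
  have CC: "C * Ci = 1" "Ci * C = 1"
    unfolding C' Ci_def mult.assoc using W by (simp_all only: U' mult.assoc[symmetric] U mult_1_right)
  have CC': "C * (Ci * x) = x" "Ci * (C * x) = x" for x
    using CC by (metis mult.assoc mult_1_left)+
  have WAB: "W * (Ai * (B * x)) = Ai * x" for x
    by (simp add: W_def mult.assoc A' B')
  \<comment> \<open>This yields the Schur complement
    \<open>D - C Ai B = 1 - Ai = Ai (A - 1)\<close>, so invertibility of \<open>A - 1\<close> makes
    S bijective.\<close>
  have CAB: "C * (Ai * (B * x)) = Ai * x - W * (B * x)" for x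
    by (simp add: C' algebra_simps WAB A')
  have canc: "A * x = A * y \<longleftrightarrow> x = y" "B * x = B * y \<longleftrightarrow> x = y" "C * x = C * y \<longleftrightarrow> x = y"
      "W * x = W * y \<longleftrightarrow> x = y" "(A - 1) * x = (A - 1) * y \<longleftrightarrow> x = y" for x y
    by (rule unit_left_cancel[OF A(2)] unit_left_cancel[OF B(2)] unit_left_cancel[OF CC(2)]
      unit_left_cancel[OF W(2)] unit_left_cancel[OF A1(2)])+
  show ?thesis
  proof
    show "\<exists>v. v \<noteq> 0" by (rule exI[of _ 1]) simp
  next
    fix a b a' b' assume 1: "A * a + B * b = A * a' + B * b'" and 2: "C * a + D * b = C * a' + D * b'"
    define u v where "u = a - a'" and "v = b - b'"
    have "A * u = - (B * v)" and 3: "C * u + D * v = 0"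
      using 1 2 by (simp_all add: u_def v_def algebra_simps)
    then have u: "u = - (Ai * (B * v))"
      using A'(2)[of u] by simp
    have "v = Ai * v"
      using 3 unfolding u by (simp add: CAB D' algebra_simps)
    then have "A * v = v"
      using A'(1)[of v] by metis
    then have "(A - 1) * v = (A - 1) * 0"
      by (simp add: left_diff_distrib)
    then have "v = 0" by (simp only: canc)
    with u show "a = a' \<and> b = b'" by (simp add: u_def v_def)
  next
    fix c d
    \<comment> \<open>Block elimination: \<open>b\<close> solves
      \<open>(1 - Ai) b = d - C Ai c\<close>, and then \<open>a\<close> follows from the first
      row.\<close>
    define b where "b = Ui * (A * (d - C * (Ai * c)))"
    define a where "a = Ai * (c - B * b)"
    have "A * a + B * b = c" by (simp add: a_def A')
    moreover have "b - Ai * b = d - C * (Ai * c)"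
    proof -
      have "A * (b - Ai * b) = (A - 1) * b"
        by (simp add: right_diff_distrib left_diff_distrib A')
      also have "\<dots> = A * (d - C * (Ai * c))"
        by (simp add: b_def mult.assoc[symmetric] A1)
      finally show ?thesis by (simp only: canc)
    qed
    then have "C * a + D * b = d"
      by (simp add: a_def right_diff_distrib CAB D' left_diff_distrib mult.assoc) (simp add: algebra_simps)
    ultimately show "\<exists>a b. A * a + B * b = c \<and> C * a + D * b = d" by blast
  next
    fix a c show "\<exists>b. A * a + B * b = c"
      by (rule exI[of _ "Bi * (c - A * a)"]) (simp add: B' algebra_simps)
  next
    fix b d show "\<exists>a. C * a + D * b = d"
      by (rule exI[of _ "Ci * (d - D * b)"]) (simp add: CC' algebra_simps)
  next
    fix a b
    \<comment> \<open>Both fixed-point equations say \<open>B b = (1 - A) a\<close>, the second one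
      after multiplication by the unit \<open>W\<close>.\<close>
    have "A * a + B * b = a \<longleftrightarrow> W * (B * b) = W * ((1 - A) * a)"
      unfolding canc by (auto simp: algebra_simps)
    also have "\<dots> \<longleftrightarrow> C * a + D * b = b"
      by (auto simp: C' D' algebra_simps)
    finally show "A * a + B * b = a \<longleftrightarrow> C * a + D * b = b" .
  next
    fix a b c
    have "A * (A * a) + B * (A * (C * a)) + (A * (B * b) + B * (A * (D * b))) = A * a + B * (A * b)"
      using e1 e2 by (metis distrib_right mult.assoc)
    then show "A * (A * a + B * b) + B * (A * (C * a + D * b) + B * c) = A * a + B * (A * b + B * c)"
      by (simp add: algebra_simps)
    have "A * (C * a) = C * (A * a) + D * (A * (C * a))"
      using e3 by (metis distrib_right mult.assoc)
    moreover have "C * (B * b) + D * (A * (D * b)) = A * (D * (A * b)) + B * (C * b)"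
      using e4 by (metis distrib_right mult.assoc)
    moreover have "D * (B * c) = A * (D * (B * c)) + B * (D * c)"
      using e5 by (metis distrib_right mult.assoc)
    ultimately have "(C * (A * a) + D * (A * (C * a))) + (C * (B * b) + D * (A * (D * b))) + D * (B * c) =
        A * (C * a) + (A * (D * (A * b)) + B * (C * b)) + (A * (D * (B * c)) + B * (D * c))"
      by metis
    then show "C * (A * a + B * b) + D * (A * (C * a + D * b) + B * c) =
        A * (C * a + D * (A * b + B * c)) + B * (C * b + D * c)"
      by (simp add: algebra_simps)
    have "C * (D * b) = C * (D * (A * b)) + D * (C * b)"
      using e6 by (metis distrib_right mult.assoc)
    moreover have "D * c = C * (D * (B * c)) + D * (D * c)"
      using e7 by (metis distrib_right mult.assoc)
    ultimately have "C * (C * a) + C * (D * b) + D * c =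
        C * (C * a) + (C * (D * (A * b)) + D * (C * b)) + (C * (D * (B * c)) + D * (D * c))"
      by metis
    then show "C * (C * a + D * b) + D * c =
        C * (C * a + D * (A * b + B * c)) + D * (C * b + D * c)"
      by (simp add: algebra_simps)
  qed (simp_all add: canc)
qed

section \<open>Colourings and the Reidemeister moves\<close>

text \<open>Moves cut circles into open strands, so the labels at both ends are arguments: words
  concatenate at a common label, and the empty word passes its label on. A circle is a flow with
  equal ends; for an empty circle that label is free.\<close>

fun flow :: "('e \<Rightarrow> 'v) \<Rightarrow> ('e \<Rightarrow> 'v) \<Rightarrow> 'v \<Rightarrow> 'e list \<Rightarrow> 'v \<Rightarrow> bool" where
  "flow i j p [] q \<longleftrightarrow> p = q"
| "flow i j p (e # w) q \<longleftrightarrow> i e = p \<and> flow i j (j e) w q"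

lemma flow_append: "flow i j p (u @ w) q \<longleftrightarrow> (\<exists>r. flow i j p u r \<and> flow i j r w q)"
  by (induction u arbitrary: p) auto

lemma flow_cong:
  "(\<And>e. e \<in> set w \<Longrightarrow> i e = i' e \<and> j e = j' e) \<Longrightarrow> flow i j p w q \<longleftrightarrow> flow i' j' p w q"
  by (induction w arbitrary: p) auto

lemma flow_map: "flow i j p (map h w) q \<longleftrightarrow> flow (i \<circ> h) (j \<circ> h) p w q"
  by (induction w arbitrary: p) auto

lemma flow_last: "flow i j p w q \<Longrightarrow> w \<noteq> [] \<Longrightarrow> q = j (last w)"
  by (induction w arbitrary: p) auto

lemma flow_hd: "flow i j p w q \<Longrightarrow> w \<noteq> [] \<Longrightarrow> p = i (hd w)"
  by (cases w) auto

lemma flow_nth: "flow i j p w q \<Longrightarrow> Suc k < length w \<Longrightarrow> i (w ! Suc k) = j (w ! k)"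
proof (induction w arbitrary: p k)
  case (Cons e w)
  then show ?case by (cases k; cases w) auto
qed simp

lemma closed_flow_rotate: "(\<exists>p. flow i j p (rotate1 w) p) \<longleftrightarrow> (\<exists>p. flow i j p w p)"
  by (cases w) (auto simp: flow_append)

lemma closed_flow_pred:
  assumes "flow i j p w p" "k < length w"
  shows "i (w ! k) = j (w ! ((k + length w - 1) mod length w))"
proof (cases k)
  case 0
  with assms show ?thesis
    using flow_last[OF assms(1)] flow_hd[OF assms(1)] by (cases w) (auto simp: last_conv_nth)
next
  case (Suc k')
  then have "(k + length w - 1) mod length w = k'" using assms(2) by simp
  then show ?thesis using flow_nth[OF assms(1)] assms(2) Suc by simp
qed

lemma flow_nthI:
  "w \<noteq> [] \<Longrightarrow> (\<And>k. Suc k < length w \<Longrightarrow> i (w ! Suc k) = j (w ! k)) \<Longrightarrow>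
   flow i j (i (hd w)) w (j (last w))"
proof (induction w)
  case (Cons e w)
  show ?case
  proof (cases w)
    case (Cons e' w')
    have "flow i j (i (hd w)) w (j (last w))"
    proof (rule Cons.IH)
      show "i (w ! Suc k) = j (w ! k)" if "Suc k < length w" for k
        using Cons.prems(2)[of "Suc k"] that by simp
    qed (simp add: \<open>w = e' # w'\<close>)
    moreover have "i e' = j e" using Cons.prems(2)[of 0] \<open>w = e' # w'\<close> by simp
    ultimately show ?thesis using \<open>w = e' # w'\<close> by simp
  qed simp
qed simp

lemma closed_flowI:
  assumes "\<And>k. k < length w \<Longrightarrow> i (w ! k) = j (w ! ((k + length w - 1) mod length w))"
  shows "\<exists>p. flow i j p w p"
proof (cases "w = []")
  case False
  have "i (hd w) = j (last w)"
    using assms[of 0] False by (simp add: hd_conv_nth last_conv_nth)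
  moreover have "i (w ! Suc k) = j (w ! k)" if "Suc k < length w" for k
    using assms[OF that] that by simp
  ultimately show ?thesis using flow_nthI[OF False, of i j] by auto
qed simp

lemma flow_zero: "flow i j z w q \<Longrightarrow> (\<And>e. e \<in> set w \<Longrightarrow> j e = z) \<Longrightarrow> q = z"
  by (cases "w = []") (auto dest: flow_last)

context switch begin

text \<open>\<open>ui\<close>, \<open>oi\<close> (\<open>vu\<close>, \<open>vo\<close>) are the labels of the incoming (outgoing) under- and over-strand;
  \<open>i e\<close> and \<open>j e\<close> are the labels of the semi-arcs that enter and leave passage \<open>e\<close>.\<close>

definition crossing :: "bool \<Rightarrow> 'v \<Rightarrow> 'v \<Rightarrow> 'v \<Rightarrow> 'v \<Rightarrow> bool" where
  "crossing s ui oi vo vu \<longleftrightarrow>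
     (if s then f ui oi = vo \<and> g ui oi = vu else f vu vo = oi \<and> g vu vo = ui)"

definition coloured_at :: "(nat \<Rightarrow> bool) \<Rightarrow> (gentry \<Rightarrow> 'v) \<Rightarrow> (gentry \<Rightarrow> 'v) \<Rightarrow> nat \<Rightarrow> bool" where
  "coloured_at s i j x \<longleftrightarrow> crossing (s x) (i (x, False)) (i (x, True)) (j (x, True)) (j (x, False))"

text \<open>A circle without crossings has a free label, so its presence guarantees a nonzero colouring.\<close>

definition colourable :: "gdiag \<Rightarrow> bool" where
  "colourable D \<longleftrightarrow> (\<exists>i j. (\<forall>x\<in>gd_crossings (fst D). coloured_at (snd D) i j x) \<and>
      (\<forall>w\<in>set (fst D). \<exists>p. flow i j p w p) \<and>
      ([] \<in> set (fst D) \<or> (\<exists>e\<in>set (concat (fst D)). j e \<noteq> z)))"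

lemma f_zero_iff: "f z b = z \<longleftrightarrow> b = z" using f_inj f_zero by metis
lemma g_zero_iff: "g a z = z \<longleftrightarrow> a = z" using g_inj g_zero by metis
lemma fg_zero: "f a b = z \<Longrightarrow> g a b = z \<Longrightarrow> a = z \<and> b = z" using inj f_zero g_zero by metis

text \<open>The third move. \<open>p0, p1, p2\<close>, \<open>q0, q1, q2\<close> and
  \<open>r0, r1, r2\<close> label the top, middle and bottom strand; \<open>t\<close>,
  \<open>m\<close>, \<open>b\<close> tell in which order each strand meets its two crossings, and
  flipping \<open>r\<close> reverses all three signs. The move swaps the order on each strand and
  keeps the six outer labels.\<close>

lemma triangle_rel:
  assumes "sx = (t = (m = r))" "sy = (t = (b = r))" "sz = (m = (b = r))"
  assumes "crossing sx (if m then q0 else q1) (if t then p0 else p1) (if t then p1 else p2) (if m then q1 else q2)"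
   "crossing sy (if b then r0 else r1) (if t then p1 else p0) (if t then p2 else p1) (if b then r1 else r2)"
   "crossing sz (if b then r1 else r0) (if m then q1 else q0) (if m then q2 else q1) (if b then r2 else r1)"
  shows "\<exists>p1 q1 r1. crossing sx (if \<not> m then q0 else q1) (if \<not> t then p0 else p1) (if \<not> t then p1 else p2) (if \<not> m then q1 else q2)
   \<and> crossing sy (if \<not> b then r0 else r1) (if \<not> t then p1 else p0) (if \<not> t then p2 else p1) (if \<not> b then r1 else r2)
   \<and> crossing sz (if \<not> b then r1 else r0) (if \<not> m then q1 else q0) (if \<not> m then q2 else q1) (if \<not> b then r2 else r1)"
proof -
  define R where "R a b c d \<longleftrightarrow> f a b = c \<and> g a b = d" for a b c d
  have cr: "crossing s ui oi vo vu \<longleftrightarrow> (if s then R ui oi vo vu else R vu vo oi ui)" for s ui oi vo vu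
    by (simp add: crossing_def R_def)
  \<comment> \<open>The two sides of the Yang--Baxter equation form a hexagon of six instances of \<open>R\<close>. Every oriented
    version of the move completes the hexagon from three edges, consecutive or alternating.\<close>
  have T1: "\<exists>u v w. R b c u v \<and> R a u m w \<and> R w v n l"
    if "R a b d e" "R e c k l" "R d k m n" for a b c d e k l m n
    using that yb1 yb2 yb3 unfolding R_def by metis
  have T4: "\<exists>d e k. R a b d e \<and> R e c k l \<and> R d k m n"
    if "R b c u v" "R a u m w" "R w v n l" for a b c l m n u v w
    using that yb1 yb2 yb3 unfolding R_def by metis
  \<comment> \<open>The labels that start the hexagon are missing: surjectivity of S supplies them,
    and injectivity identifies the labels shared with the given edges.\<close>
  have T2: "\<exists>a b u. R a b d e \<and> R b c u v \<and> R a u m w"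
    if "R e c k l" "R d k m n" "R w v n l" for c d e k l m n v w
  proof -
    obtain a b where ab: "f a b = d" "g a b = e" using surj by blast
    have 1: "f a (f b c) = m" "f (g a (f b c)) (g b c) = n" "g (g a (f b c)) (g b c) = l"
      using ab that yb1[of a b c] yb2[of a b c] yb3[of a b c] unfolding R_def by auto
    then have "g a (f b c) = w" "g b c = v" using inj that unfolding R_def by metis+
    then show ?thesis using ab 1(1) unfolding R_def by blast
  qed
  have T5: "\<exists>k l n. R e c k l \<and> R d k m n \<and> R w v n l"
    if "R a b d e" "R b c u v" "R a u m w" for a b c d e m u v w
    using that yb1 yb2 yb3 unfolding R_def by metis
  have T3: "\<exists>e b c. R a b d e \<and> R e c k l \<and> R b c u v"
    if "R d k m n" "R w v n l" "R a u m w" for a d k l m n u v w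
  proof -
    obtain b c where bc: "f b c = u" "g b c = v" using surj by blast
    have 1: "f (f a b) (f (g a b) c) = m" "g (f a b) (f (g a b) c) = n" "g (g a b) c = l"
      using bc that yb1[of a b c] yb2[of a b c] yb3[of a b c] unfolding R_def by auto
    then have "f a b = d" "f (g a b) c = k" using inj that unfolding R_def by metis+
    then show ?thesis using bc 1(3) unfolding R_def by blast
  qed
  have T6: "\<exists>m n w. R d k m n \<and> R w v n l \<and> R a u m w"
    if "R a b d e" "R e c k l" "R b c u v" for a b c d e k l u v
    using that yb1 yb2 yb3 unfolding R_def by metis
  \<comment> \<open>No two of the given edges are consecutive, so S cannot be inverted as a whole;
    \<open>a\<close> is recovered sideways from one input and one output.\<close>
  have T7: "\<exists>a d m. R a b d e \<and> R d k m n \<and> R a u m w"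
    if "R e c k l" "R b c u v" "R w v n l" for b c e k l n u v w
  proof -
    obtain a where a: "g a b = e" using g_surj by blast
    have 1: "f (f a b) k = f a u" "g (f a b) k = f (g a u) v" "l = g (g a u) v"
      using a that yb1[of a b c] yb2[of a b c] yb3[of a b c] unfolding R_def by auto
    then have "g a u = w" using g_inj that unfolding R_def by metis
    then show ?thesis using a 1 that unfolding R_def by metis
  qed
  have T8: "\<exists>c v l. R e c k l \<and> R b c u v \<and> R w v n l"
    if "R a b d e" "R d k m n" "R a u m w" for a b d e k m n u w
  proof -
    obtain c where c: "f e c = k" using f_surj by blast
    have 1: "m = f a (f b c)" "n = f (g a (f b c)) (g b c)" "g e c = g (g a (f b c)) (g b c)"
      using c that yb1[of a b c] yb2[of a b c] yb3[of a b c] unfolding R_def by auto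
    then have "f b c = u" using f_inj that unfolding R_def by metis
    then show ?thesis using c 1 that unfolding R_def by metis
  qed
  show ?thesis
    using assms(4-6) unfolding assms(1-3) cr
    by (cases t; cases m; cases b; cases r; simp only: simp_thms if_True if_False)
      ((drule (2) T1, fast) | (drule (2) T2, fast) | (drule (2) T3, fast) | (drule (2) T4, fast)
      | (drule (2) T5, fast) | (drule (2) T6, fast) | (drule (2) T7, fast) | (drule (2) T8, fast))+
qed

text \<open>Ensures that the inner semi-arcs of the triangle never carry the only nonzero labels of
  a diagram.\<close>

lemma triangle_rel_zero:
  assumes "sx = (t = (m = r))" "sy = (t = (b = r))" "sz = (m = (b = r))"
  assumes "crossing sx (if m then z else q1) (if t then z else p1) (if t then p1 else z) (if m then q1 else z)"
   "crossing sy (if b then z else r1) (if t then p1 else z) (if t then z else p1) (if b then r1 else z)"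
   "crossing sz (if b then r1 else z) (if m then q1 else z) (if m then z else q1) (if b then z else r1)"
  shows "p1 = z \<and> q1 = z \<and> r1 = z"
  using assms(4-6) unfolding assms(1-3) crossing_def
  by (cases t; cases m; cases b; cases r; simp only: simp_thms if_True if_False)
    (metis f_zero_iff g_zero_iff f_zero g_zero fg_zero)+

end

section \<open>Cutting a diagram at the slots of a template\<close>

definition fill_word :: "(nat \<Rightarrow> gentry list) \<Rightarrow> (gentry + nat) list \<Rightarrow> gentry list" where
  "fill_word W cs = concat (map (\<lambda>z. case z of Inl e \<Rightarrow> [e] | Inr i \<Rightarrow> W i) cs)"

lemma fill_word_simps [simp]:
  "fill_word W [] = []" "fill_word W (Inl e # cs) = e # fill_word W cs"
  "fill_word W (Inr k # cs) = W k @ fill_word W cs"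
  by (simp_all add: fill_word_def)

lemma gd_fill_conv [simp]: "gd_fill W C = map (fill_word W) C"
  by (simp add: fill_word_def[abs_def])

declare gd_fill.simps [simp del]

text \<open>Cuts a labelled strand at its slots. Since no slot occurs twice, its end labels can be
  recorded as functions of the slot number.\<close>

lemma flow_fill_word:
  assumes "flow i j p (fill_word W cs) q" and "\<forall>k. count_list cs (Inr k) \<le> 1"
  shows "\<exists>u v. flow (case_sum i u) (case_sum j v) p cs q \<and>
           (\<forall>k. Inr k \<in> set cs \<longrightarrow> flow i j (u k) (W k) (v k))"
  using assms
proof (induction cs arbitrary: p)
  case (Cons c cs)
  have cnt: "\<forall>k. count_list cs (Inr k) \<le> 1"
    using Cons.prems(2) by (metis count_list.simps(2) le_add1 le_trans)
  show ?case
  proof (cases c)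
    case (Inl e)
    then obtain u v where "flow (case_sum i u) (case_sum j v) (j e) cs q"
      "\<forall>k. Inr k \<in> set cs \<longrightarrow> flow i j (u k) (W k) (v k)"
      using Cons.IH[OF _ cnt, of "j e"] Cons.prems(1) by auto
    then show ?thesis using Cons.prems(1) Inl by (intro exI[of _ u] exI[of _ v]) auto
  next
    case (Inr k)
    then obtain r where r: "flow i j p (W k) r" "flow i j r (fill_word W cs) q"
      using Cons.prems(1) by (auto simp: flow_append)
    obtain u v where uv: "flow (case_sum i u) (case_sum j v) r cs q"
      "\<forall>k. Inr k \<in> set cs \<longrightarrow> flow i j (u k) (W k) (v k)"
      using Cons.IH[OF r(2) cnt] by auto
    have k: "Inr k \<notin> set cs"
      using Cons.prems(2)[rule_format, of k] Inr by (simp add: count_list_0_iff)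
    have "flow (case_sum i (u(k := p))) (case_sum j (v(k := r))) r cs q"
      using uv(1) by (rule flow_cong[THEN iffD1, rotated]) (use k in \<open>auto split: sum.splits\<close>)
    then show ?thesis using Inr r(1) uv(2) k
      by (intro exI[of _ "u(k := p)"] exI[of _ "v(k := r)"]) auto
  qed
qed simp

lemma fill_word_flow:
  assumes "flow (case_sum i u) (case_sum j v) p cs q"
    and "\<And>k. Inr k \<in> set cs \<Longrightarrow> flow i j (u k) (W k) (v k)"
  shows "flow i j p (fill_word W cs) q"
  using assms
proof (induction cs arbitrary: p)
  case (Cons c cs)
  then show ?case by (cases c) (auto simp: flow_append)
qed simp

lemma closed_flows_fill:
  assumes "\<forall>cs\<in>set C. flow i j (P cs) (fill_word W cs) (P cs)"
    and "\<forall>k. count_list (concat C) (Inr k) \<le> 1"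
  shows "\<exists>u v. (\<forall>cs\<in>set C. flow (case_sum i u) (case_sum j v) (P cs) cs (P cs)) \<and>
           (\<forall>k. Inr k \<in> set (concat C) \<longrightarrow> flow i j (u k) (W k) (v k))"
  using assms
proof (induction C)
  case (Cons cs C)
  have cnt: "\<forall>k. count_list cs (Inr k) \<le> 1" "\<forall>k. count_list (concat C) (Inr k) \<le> 1"
    using Cons.prems(2) by (simp_all add: count_list_append) (metis add_leE)+
  have disj: "Inr k \<notin> set (concat C)" if "Inr k \<in> set cs" for k
  proof -
    have "count_list cs (Inr k) \<noteq> 0" using that by (simp add: count_list_0_iff)
    then have "count_list (concat C) (Inr k) = 0"
      using Cons.prems(2)[rule_format, of k] by (simp add: count_list_append)
    then show ?thesis by (simp only: count_list_0_iff not_False_eq_True)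
  qed
  obtain u v where uv: "\<forall>cs\<in>set C. flow (case_sum i u) (case_sum j v) (P cs) cs (P cs)"
      "\<forall>k. Inr k \<in> set (concat C) \<longrightarrow> flow i j (u k) (W k) (v k)"
    using Cons.IH cnt Cons.prems(1) by auto
  obtain u' v' where uv': "flow (case_sum i u') (case_sum j v') (P cs) cs (P cs)"
      "\<forall>k. Inr k \<in> set cs \<longrightarrow> flow i j (u' k) (W k) (v' k)"
    using flow_fill_word[OF _ cnt(1)] Cons.prems(1) by (metis list.set_intros(1))
  define U where "U k = (if Inr k \<in> set cs then u' k else u k)" for k
  define V where "V k = (if Inr k \<in> set cs then v' k else v k)" for k
  have "flow (case_sum i U) (case_sum j V) (P cs) cs (P cs)"
    using uv'(1) by (rule flow_cong[THEN iffD1, rotated]) (auto simp: U_def V_def split: sum.splits)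
  moreover have "flow (case_sum i U) (case_sum j V) (P ds) ds (P ds)" if "ds \<in> set C" for ds
    using uv(1)[rule_format, OF that]
    by (rule flow_cong[THEN iffD1, rotated]) (use that disj in \<open>auto simp: U_def V_def split: sum.splits\<close>)
  moreover have "flow i j (U k) (W k) (V k)" if "Inr k \<in> set (concat (cs # C))" for k
    using uv(2) uv'(2) that by (auto simp: U_def V_def)
  ultimately show ?case by (intro exI[of _ U] exI[of _ V]) auto
qed simp

section \<open>Replacing a tangle inside a coloured diagram\<close>

context switch begin

text \<open>The end labels \<open>u\<close>, \<open>v\<close> of the strands are arguments because a
  move keeps exactly these fixed while the labels inside may change.\<close>

definition tangle_coloured ::
  "(nat \<Rightarrow> bool) \<Rightarrow> (nat \<Rightarrow> gentry list) \<Rightarrow> nat \<Rightarrow> (gentry \<Rightarrow> 'v) \<Rightarrow> (gentry \<Rightarrow> 'v) \<Rightarrow>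
   (nat \<Rightarrow> 'v) \<Rightarrow> (nat \<Rightarrow> 'v) \<Rightarrow> bool" where
  "tangle_coloured s W h i j u v \<longleftrightarrow> (\<forall>k<h. flow i j (u k) (W k) (v k)) \<and>
     (\<forall>k<h. \<forall>e\<in>set (W k). coloured_at s i j (fst e))"

text \<open>A colouring of the filled diagram is a colouring of the template \<open>C\<close>, in which a slot counts as a
  passage with labels \<open>u k\<close> and \<open>v k\<close>, together with one of the inserted tangle.\<close>

lemma colourable_replace:
  assumes count: "\<forall>k<h. count_list (concat C) (Inr k) = 1"
    and slots: "\<forall>k. Inr k \<in> set (concat C) \<longrightarrow> k < h"
    and disj: "\<forall>k<h. \<forall>e\<in>set (W k @ W' k). \<forall>ov. Inl (fst e, ov) \<notin> set (concat C)"
    and signs: "\<forall>x ov. Inl (x, ov) \<in> set (concat C) \<longrightarrow> s x = s' x"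
    and ex: "\<And>i j u v. tangle_coloured s W h i j u v \<Longrightarrow> \<exists>i j. tangle_coloured s' W' h i j u v"
    and zero: "\<And>i j u v. tangle_coloured s W h i j u v \<Longrightarrow> \<forall>k<h. u k = z \<and> v k = z \<Longrightarrow>
                 \<forall>k<h. \<forall>e\<in>set (W k). j e = z"
    and col: "colourable (gd_fill W C, s)"
  shows "colourable (gd_fill W' C, s')"
proof -
  have slot_in: "Inr k \<in> set (concat C)" if "k < h" for k
    using count that by (metis count_list_0_iff zero_neq_one)
  have cnt: "\<forall>k. count_list (concat C) (Inr k) \<le> 1"
    using count slots by (metis count_list_0_iff le_refl zero_le_one)
  define K where "K = set (concat C)"
  have K_iff: "Inr k \<in> K \<longleftrightarrow> k < h" for k
    unfolding K_def using slots slot_in by blast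
  have K_word: "c \<in> K" if "cs \<in> set C" "c \<in> set cs" for c cs
    using that unfolding K_def by auto
  have mem_fill: "e \<in> set (concat (gd_fill V C)) \<longleftrightarrow> Inl e \<in> K \<or> (\<exists>k<h. e \<in> set (V k))" for V e
  proof -
    have 1: "set (concat (gd_fill V C)) = (\<Union>c\<in>K. set (case c of Inl e \<Rightarrow> [e] | Inr i \<Rightarrow> V i))"
      by (auto simp: fill_word_def K_def)
    have 2: "e \<in> set (case c of Inl e \<Rightarrow> [e] | Inr i \<Rightarrow> V i) \<longleftrightarrow>
        c = Inl e \<or> (\<exists>k. c = Inr k \<and> e \<in> set (V k))" for c
      by (cases c) auto
    show ?thesis
      unfolding 1 UN_iff 2 using K_iff by metis
  qed
  have crossing_fill: "x \<in> gd_crossings (gd_fill V C) \<longleftrightarrow> (\<exists>ov. (x, ov) \<in> set (concat (gd_fill V C)))" for V x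
    unfolding gd_crossings_def by force
  obtain i j where col1: "\<And>x. x \<in> gd_crossings (gd_fill W C) \<Longrightarrow> coloured_at s i j x"
    and closed: "\<And>w. w \<in> set (gd_fill W C) \<Longrightarrow> \<exists>p. flow i j p w p"
    and nz: "[] \<in> set (gd_fill W C) \<or> (\<exists>e\<in>set (concat (gd_fill W C)). j e \<noteq> z)"
    using col unfolding colourable_def fst_conv snd_conv by blast
  \<comment> \<open>A circle that is empty before the move has no passage to show its label, so it
    is given a nonzero one; the contradiction at the end of the proof rests on this choice.\<close>
  obtain v0 where v0: "v0 \<noteq> z" using nontrivial by blast
  have "\<exists>p. flow i j p (fill_word W cs) p \<and> (fill_word W cs = [] \<longrightarrow> p \<noteq> z)" if "cs \<in> set C" for cs
  proof (cases "fill_word W cs = []")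
    case True
    then show ?thesis using v0 by (intro exI[of _ v0]) simp
  next
    case False
    have "fill_word W cs \<in> set (gd_fill W C)" using that by auto
    with closed False show ?thesis by blast
  qed
  then obtain P where P: "\<And>cs. cs \<in> set C \<Longrightarrow> flow i j (P cs) (fill_word W cs) (P cs)"
    "\<And>cs. cs \<in> set C \<Longrightarrow> fill_word W cs = [] \<Longrightarrow> P cs \<noteq> z"
    by metis
  obtain u v where T: "\<And>cs. cs \<in> set C \<Longrightarrow> flow (case_sum i u) (case_sum j v) (P cs) cs (P cs)"
    and uv: "\<And>k. Inr k \<in> set (concat C) \<Longrightarrow> flow i j (u k) (W k) (v k)"
    using closed_flows_fill[of C i j P W] P(1) cnt by blast
  have tc: "tangle_coloured s W h i j u v"
    unfolding tangle_coloured_def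
  proof (intro conjI allI impI ballI)
    fix k e assume "k < h" "e \<in> set (W k)"
    then have "e \<in> set (concat (gd_fill W C))" unfolding mem_fill by blast
    then show "coloured_at s i j (fst e)" by (intro col1) (unfold gd_crossings_def, blast)
  qed (use uv slot_in in blast)
  obtain i1 j1 where tc1: "tangle_coloured s' W' h i1 j1 u v" using ex[OF tc] by blast
  \<comment> \<open>The new colouring is used at the crossings of the inserted tangle and the old
    one elsewhere; by \<open>disj\<close> no passage of the template lies over
    \<open>X'\<close>.\<close>
  define X' where "X' = (\<Union>k<h. fst ` set (W' k))"
  define i' where "i' e = (if fst e \<in> X' then i1 e else i e)" for e
  define j' where "j' e = (if fst e \<in> X' then j1 e else j e)" for e
  have in_X': "fst e \<in> X'" if "k < h" "e \<in> set (W' k)" for k e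
    using that by (auto simp: X'_def)
  have notin_X': "x \<notin> X'" if "Inl (x, ov) \<in> K" for x ov
    using disj that unfolding X'_def K_def by fastforce
  have T': "flow (case_sum i' u) (case_sum j' v) (P cs) cs (P cs)" if "cs \<in> set C" for cs
    using T[OF that]
  proof (rule flow_cong[THEN iffD1, rotated])
    fix c assume "c \<in> set cs"
    then have "c \<in> K" using that K_word by blast
    then show "case_sum i u c = case_sum i' u c \<and> case_sum j v c = case_sum j' v c"
      using notin_X' by (auto simp: i'_def j'_def split: sum.splits)
  qed
  have inner': "flow i' j' (u k) (W' k) (v k)" if "k < h" for k
    using tc1 that unfolding tangle_coloured_def
    by (metis (mono_tags, lifting) flow_cong i'_def j'_def in_X')
  have F': "flow i' j' (P cs) (fill_word W' cs) (P cs)" if "cs \<in> set C" for cs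
    using T'[OF that] by (rule fill_word_flow) (use that slots inner' in auto)
  have "coloured_at s' i' j' x" if x: "x \<in> gd_crossings (gd_fill W' C)" for x
  proof -
    obtain ov where ov: "Inl (x, ov) \<in> K \<or> (\<exists>k<h. (x, ov) \<in> set (W' k))"
      using x unfolding crossing_fill mem_fill by blast
    show ?thesis
    proof (cases "x \<in> X'")
      case True
      then have "coloured_at s' i1 j1 x" using tc1 unfolding X'_def tangle_coloured_def by auto
      then show ?thesis using True by (simp add: coloured_at_def i'_def j'_def)
    next
      case False
      then have 1: "Inl (x, ov) \<in> K" using ov in_X' by fastforce
      then have "coloured_at s i j x"
        by (intro col1) (unfold crossing_fill mem_fill, blast)
      moreover have "s x = s' x" using signs 1 unfolding K_def by blast
      ultimately show ?thesis using False by (simp add: coloured_at_def i'_def j'_def)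
    qed
  qed
  moreover have "\<exists>p. flow i' j' p w p" if "w \<in> set (gd_fill W' C)" for w
    using F' that by auto
  \<comment> \<open>If all labels after the move were zero, every circle would start at zero and all
    slot ends would be zero. Then \<open>zero\<close> annihilates the old inner labels as well, so
    the old diagram had an empty circle, whose label was chosen nonzero.\<close>
  moreover have "[] \<in> set (gd_fill W' C) \<or> (\<exists>e\<in>set (concat (gd_fill W' C)). j' e \<noteq> z)"
  proof (rule ccontr)
    assume "\<not> ?thesis"
    then have ne: "[] \<notin> set (gd_fill W' C)" and z': "\<And>e. e \<in> set (concat (gd_fill W' C)) \<Longrightarrow> j' e = z"
      by auto
    have P0: "P cs = z" if "cs \<in> set C" for cs
    proof -
      have "fill_word W' cs \<in> set (gd_fill W' C)" using that by auto
      then have "fill_word W' cs \<noteq> []" and "set (fill_word W' cs) \<subseteq> set (concat (gd_fill W' C))"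
        using ne by auto
      then show ?thesis using flow_last[OF F'[OF that]] z' last_in_set by blast
    qed
    have j'z: "j' e = z" if "Inl e \<in> K \<or> (\<exists>k<h. e \<in> set (W' k))" for e
      using z' that mem_fill by blast
    have jz: "j e = z" if "Inl e \<in> K" for e
      using j'z[of e] that notin_X'[of "fst e" "snd e"] by (simp add: j'_def)
    \<comment> \<open>Following a circle from a zero label, every passage and every slot hands on
      zero.\<close>
    have slotz: "\<forall>k. Inr k \<in> set cs \<longrightarrow> u k = z \<and> v k = z"
      if "flow (case_sum i' u) (case_sum j' v) z cs q" "set cs \<subseteq> K" for cs q
      using that
    proof (induction cs)
      case (Cons c cs)
      have "case_sum j' v c = z" "\<forall>k. c = Inr k \<longrightarrow> u k = z"
      proof -
        show "\<forall>k. c = Inr k \<longrightarrow> u k = z" using Cons.prems by auto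
        show "case_sum j' v c = z"
        proof (cases c)
          case (Inl e)
          then show ?thesis using Cons.prems(2) j'z[of e] by simp
        next
          case (Inr k)
          then have k: "k < h" "u k = z" using Cons.prems K_iff by auto
          then have "flow i' j' z (W' k) (v k)" using inner'[of k] by simp
          then have "v k = z" by (rule flow_zero) (use j'z k in blast)
          then show ?thesis using Inr by simp
        qed
      qed
      then show ?case using Cons by auto
    qed simp
    have "\<forall>k<h. u k = z \<and> v k = z"
    proof (intro allI impI)
      fix k assume "k < h"
      then obtain cs where cs: "cs \<in> set C" "Inr k \<in> set cs" using slot_in by fastforce
      have "set cs \<subseteq> K" using K_word[OF cs(1)] by blast
      then show "u k = z \<and> v k = z" using slotz T'[OF cs(1)] cs(2) P0[OF cs(1)] by metis
    qed
    then have "\<forall>k<h. \<forall>e\<in>set (W k). j e = z" by (rule zero[OF tc])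
    then have "\<forall>e\<in>set (concat (gd_fill W C)). j e = z"
      using jz mem_fill by blast
    with nz have "[] \<in> set (gd_fill W C)" by blast
    then obtain cs where "cs \<in> set C" "fill_word W cs = []" by auto
    then show False using P(2) P0 by blast
  qed
  ultimately show ?thesis unfolding colourable_def fst_conv snd_conv by blast
qed

end

section \<open>The three Reidemeister moves on coloured tangles\<close>

lemma reid_pattern_cases:
  assumes "reid_pattern h W W' s s'"
  obtains (R1) x ov where "h = 1" "W 0 = []" "W' 0 = [(x, ov), (x, \<not> ov)]"
  | (R2) x y where "h = 2" "W 0 = []" "W 1 = []" "x \<noteq> y" "W' 0 = [(x, True), (y, True)]"
      "W' 1 = [(x, False), (y, False)] \<or> W' 1 = [(y, False), (x, False)]" "s' x \<noteq> s' y"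
  | (R3) x y w t m b r where "h = 3" "distinct [x, y, w]"
      "W 0 = (if t then [(x, True), (y, True)] else [(y, True), (x, True)])"
      "W 1 = (if m then [(x, False), (w, True)] else [(w, True), (x, False)])"
      "W 2 = (if b then [(y, False), (w, False)] else [(w, False), (y, False)])"
      "\<forall>i<3. W' i = rev (W i)" "s x = s' x" "s y = s' y" "s w = s' w"
      "s x = (t = (m = r))" "s y = (t = (b = r))" "s w = (m = (b = r))"
  using assms[unfolded reid_pattern_def]
proof (elim disjE)
  assume "h = 1 \<and> W 0 = [] \<and> (\<exists>x ov. W' 0 = [(x, ov), (x, \<not> ov)])"
  then show thesis using R1 by blast
next
  assume "h = 2 \<and> W 0 = [] \<and> W 1 = [] \<and>
     (\<exists>x y. x \<noteq> y \<and> W' 0 = [(x, True), (y, True)] \<and>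
        (W' 1 = [(x, False), (y, False)] \<or> W' 1 = [(y, False), (x, False)]) \<and> s' x \<noteq> s' y)"
  then show thesis using R2 by blast
qed (elim exE conjE, rule R3)

lemma all_less_1_2_3: "(\<forall>k<(1::nat). P k) \<longleftrightarrow> P 0" "(\<forall>k<(2::nat). P k) \<longleftrightarrow> P 0 \<and> P 1"
  "(\<forall>k<(3::nat). P k) \<longleftrightarrow> P 0 \<and> P 1 \<and> P 2"
  by (auto simp: less_Suc_eq numeral_3_eq_3 numeral_2_eq_2)

context switch begin

lemma crossing_simps [simp]:
  "crossing True ui oi vo vu \<longleftrightarrow> f ui oi = vo \<and> g ui oi = vu"
  "crossing False ui oi vo vu \<longleftrightarrow> f vu vo = oi \<and> g vu vo = ui"
  by (simp_all add: crossing_def)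

text \<open>The first move. The loop of a kink leaves the crossing and enters it again. By
  \<open>fix_iff\<close> the two equations for its label \<open>q\<close> are equivalent, so
  sideways surjectivity provides \<open>q\<close>, and both ends of a kink carry the same
  label.\<close>

lemma crossing_twist:
  shows "\<exists>q. crossing c q p q p" and "\<exists>q. crossing c p q p q"
    and "crossing c q p q r \<Longrightarrow> r = p" and "crossing c p q r q \<Longrightarrow> r = p"
proof -
  obtain a where a: "f p a = p" "g p a = a" using f_surj fix_iff by metis
  obtain b where b: "g b p = p" "f b p = b" using g_surj fix_iff by metis
  show "\<exists>q. crossing c q p q p" using a b by (cases c) auto
  show "\<exists>q. crossing c p q p q" using a b by (cases c) auto
  show "crossing c q p q r \<Longrightarrow> r = p" "crossing c p q r q \<Longrightarrow> r = p"
    using fix_iff[of q p] fix_iff[of p q] fix_iff[of q r] fix_iff[of r q] by (cases c; force)+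
qed

lemma crossing_twist_zero: "crossing c q z q z \<Longrightarrow> q = z" "crossing c z q z q \<Longrightarrow> q = z"
  by (cases c; simp add: f_zero_iff g_zero_iff)+

lemma twist_insert:
  assumes "W 0 = [(x, ov), (x, \<not> ov)]" "u 0 = v 0"
  shows "\<exists>i j. tangle_coloured s W 1 i j u v"
proof -
  obtain q where "if ov then crossing (s x) q (u 0) q (u 0) else crossing (s x) (u 0) q (u 0) q"
    using crossing_twist(1,2) by meson
  then show ?thesis unfolding tangle_coloured_def all_less_1_2_3 using assms
    by (intro exI[of _ "\<lambda>e. if snd e = ov then u 0 else q"] exI[of _ "\<lambda>e. if snd e = ov then q else u 0"])
       (auto simp: coloured_at_def split: if_splits)
qed

text \<open>The second move. Opposite signs make the second crossing undo the first. The first two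
  claims concern strands of equal direction and use bijectivity of S; the last two concern opposite
  directions, where S is solved sideways.\<close>

lemma parallel_rel:
  shows "\<exists>p1 q1. crossing c q0 p0 p1 q1 \<and> crossing (\<not> c) q1 p1 p0 q0"
    and "crossing c q0 p0 p1 q1 \<Longrightarrow> crossing (\<not> c) q1 p1 p2 q2 \<Longrightarrow> p2 = p0 \<and> q2 = q0"
    and "\<exists>p1 q1. crossing c q1 p0 p1 q0 \<and> crossing (\<not> c) q0 p1 p0 q1"
    and "crossing c q1 p0 p1 q2 \<Longrightarrow> crossing (\<not> c) q0 p1 p2 q1 \<Longrightarrow> p2 = p0 \<and> q2 = q0"
proof -
  show "\<exists>p1 q1. crossing c q0 p0 p1 q1 \<and> crossing (\<not> c) q1 p1 p0 q0"
    using surj[of p0 q0] by (cases c) auto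
  show "crossing c q0 p0 p1 q1 \<Longrightarrow> crossing (\<not> c) q1 p1 p2 q2 \<Longrightarrow> p2 = p0 \<and> q2 = q0"
    using inj[of q0 p0 q2 p2] by (cases c) auto
  show "\<exists>p1 q1. crossing c q1 p0 p1 q0 \<and> crossing (\<not> c) q0 p1 p0 q1"
    using f_surj[of q0 p0] g_surj[of p0 q0] by (cases c) auto
  show "crossing c q1 p0 p1 q2 \<Longrightarrow> crossing (\<not> c) q0 p1 p2 q1 \<Longrightarrow> p2 = p0 \<and> q2 = q0"
    using f_inj[of q1 p0 p2] g_inj[of q2 p1 q0] by (cases c) auto
qed

lemma parallel_rel_zero:
  "crossing c z z p1 q1 \<Longrightarrow> crossing (\<not> c) q1 p1 z z \<Longrightarrow> p1 = z \<and> q1 = z"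
  "crossing c q1 z p1 z \<Longrightarrow> crossing (\<not> c) z p1 z q1 \<Longrightarrow> p1 = z \<and> q1 = z"
  using f_zero g_zero f_zero_iff[of p1] g_zero_iff[of q1] fg_zero[of q1 p1] by (cases c; auto)+

lemma two_strands_insert:
  assumes "x \<noteq> y" "W 0 = [(x, True), (y, True)]"
    and "W 1 = [(x, False), (y, False)] \<or> W 1 = [(y, False), (x, False)]" "s x \<noteq> s y"
    and "u 0 = v 0" "u 1 = v 1"
  shows "\<exists>i j. tangle_coloured s W 2 i j u v"
  using assms(3)
proof
  assume W1: "W 1 = [(x, False), (y, False)]"
  obtain p q where "crossing (s x) (u 1) (u 0) p q" "crossing (s y) q p (u 0) (u 1)"
    using parallel_rel(1)[of "s x" "u 1" "u 0"] assms(4) by auto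
  then show ?thesis unfolding tangle_coloured_def all_less_1_2_3 using assms(1,2,5,6) W1
    by (intro exI[of _ "\<lambda>e. if fst e = x then (if snd e then u 0 else u 1) else if snd e then p else q"]
        exI[of _ "\<lambda>e. if fst e = y then (if snd e then u 0 else u 1) else if snd e then p else q"])
       (auto simp: coloured_at_def)
next
  assume W1: "W 1 = [(y, False), (x, False)]"
  obtain p q where "crossing (s x) q (u 0) p (u 1)" "crossing (s y) (u 1) p (u 0) q"
    using parallel_rel(3)[of "s x" "u 0" "u 1"] assms(4) by auto
  then show ?thesis unfolding tangle_coloured_def all_less_1_2_3 using assms(1,2,5,6) W1
    by (intro exI[of _ "\<lambda>e. if e = (x, True) then u 0 else if e = (y, True) then p
          else if e = (y, False) then u 1 else q"]
        exI[of _ "\<lambda>e. if e = (x, True) then p else if e = (y, True) then u 0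
          else if e = (y, False) then q else u 1"])
       (auto simp: coloured_at_def)
qed

lemma two_strands_remove:
  assumes "W 0 = [(x, True), (y, True)]"
    and "W 1 = [(x, False), (y, False)] \<or> W 1 = [(y, False), (x, False)]" "s x \<noteq> s y"
    and "tangle_coloured s W 2 i j u v"
  shows "u 0 = v 0 \<and> u 1 = v 1"
proof -
  have s: "s y = (\<not> s x)" using assms(3) by auto
  show ?thesis
    using assms(2)
  proof
    assume "W 1 = [(x, False), (y, False)]"
    then show ?thesis
      using assms(1,4) parallel_rel(2)[of "s x" "u 1" "u 0" "i (y, True)" "i (y, False)" "v 0" "v 1"]
      unfolding tangle_coloured_def all_less_1_2_3 coloured_at_def by (auto simp: s)
  next
    assume "W 1 = [(y, False), (x, False)]"
    then show ?thesis
      using assms(1,4) parallel_rel(4)[of "s x" "i (x, False)" "u 0" "i (y, True)" "v 1" "u 1" "v 0"]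
      unfolding tangle_coloured_def all_less_1_2_3 coloured_at_def by (auto simp: s)
  qed
qed

lemma two_strands_zero:
  assumes "W 0 = [(x, True), (y, True)]"
    and "W 1 = [(x, False), (y, False)] \<or> W 1 = [(y, False), (x, False)]" "s x \<noteq> s y"
    and "tangle_coloured s W 2 i j u v" "\<forall>k<2. u k = z \<and> v k = z"
  shows "\<forall>k<2. \<forall>e\<in>set (W k). j e = z"
proof -
  have s: "s y = (\<not> s x)" using assms(3) by auto
  show ?thesis
    using assms(2)
  proof
    assume "W 1 = [(x, False), (y, False)]"
    then show ?thesis
      using assms(1,4,5) parallel_rel_zero(1)[of "s x" "i (y, True)" "i (y, False)"]
      unfolding tangle_coloured_def all_less_1_2_3 coloured_at_def by (auto simp: s)
  next
    assume "W 1 = [(y, False), (x, False)]"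
    then show ?thesis
      using assms(1,4,5) parallel_rel_zero(2)[of "s x" "i (x, False)" "i (y, True)"]
      unfolding tangle_coloured_def all_less_1_2_3 coloured_at_def by (auto simp: s)
  qed
qed

text \<open>Each strand has a single inner semi-arc, so \<open>p1\<close>, \<open>q1\<close>,
  \<open>r1\<close> and the end labels determine everything; this brings a colouring into the form
  that \<open>triangle_rel\<close> accepts.\<close>

lemma triangle_labels:
  assumes W: "W 0 = (if t then [(x, True), (y, True)] else [(y, True), (x, True)])"
      "W 1 = (if m then [(x, False), (w, True)] else [(w, True), (x, False)])"
      "W 2 = (if b then [(y, False), (w, False)] else [(w, False), (y, False)])"
    and tc: "tangle_coloured s W 3 i j u v"
  obtains p1 q1 r1 where
    "crossing (s x) (if m then u 1 else q1) (if t then u 0 else p1) (if t then p1 else v 0) (if m then q1 else v 1)"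
    "crossing (s y) (if b then u 2 else r1) (if t then p1 else u 0) (if t then v 0 else p1) (if b then r1 else v 2)"
    "crossing (s w) (if b then r1 else u 2) (if m then q1 else u 1) (if m then v 1 else q1) (if b then v 2 else r1)"
    "j (x, True) = (if t then p1 else v 0)" "j (y, True) = (if t then v 0 else p1)"
    "j (x, False) = (if m then q1 else v 1)" "j (w, True) = (if m then v 1 else q1)"
    "j (y, False) = (if b then r1 else v 2)" "j (w, False) = (if b then v 2 else r1)"
proof -
  have f: "flow i j (u 0) (W 0) (v 0)" "flow i j (u 1) (W 1) (v 1)" "flow i j (u 2) (W 2) (v 2)"
    and c: "coloured_at s i j x" "coloured_at s i j y" "coloured_at s i j w"
    using tc unfolding tangle_coloured_def all_less_1_2_3 W by (auto split: if_splits)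
  obtain p1 where p: "i (x, True) = (if t then u 0 else p1)" "i (y, True) = (if t then p1 else u 0)"
      "j (x, True) = (if t then p1 else v 0)" "j (y, True) = (if t then v 0 else p1)"
    using f(1) W(1) by (cases t) auto
  obtain q1 where q: "i (x, False) = (if m then u 1 else q1)" "i (w, True) = (if m then q1 else u 1)"
      "j (x, False) = (if m then q1 else v 1)" "j (w, True) = (if m then v 1 else q1)"
    using f(2) W(2) by (cases m) auto
  obtain r1 where r: "i (y, False) = (if b then u 2 else r1)" "i (w, False) = (if b then r1 else u 2)"
      "j (y, False) = (if b then r1 else v 2)" "j (w, False) = (if b then v 2 else r1)"
    using f(3) W(3) by (cases b) auto
  show ?thesis
    by (rule that[OF c[unfolded coloured_at_def p q r] p(3,4) q(3,4) r(3,4)])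
qed

lemma triangle_flip:
  assumes d: "distinct [x, y, w]"
    and W: "W 0 = (if t then [(x, True), (y, True)] else [(y, True), (x, True)])"
      "W 1 = (if m then [(x, False), (w, True)] else [(w, True), (x, False)])"
      "W 2 = (if b then [(y, False), (w, False)] else [(w, False), (y, False)])"
    and W': "\<forall>i<3. W' i = rev (W i)"
    and s': "s x = s' x" "s y = s' y" "s w = s' w"
    and s: "s x = (t = (m = r))" "s y = (t = (b = r))" "s w = (m = (b = r))"
    and tc: "tangle_coloured s W 3 i j u v"
  shows "\<exists>i j. tangle_coloured s' W' 3 i j u v"
proof -
  obtain p q r' where l:
    "crossing (s x) (if m then u 1 else q) (if t then u 0 else p) (if t then p else v 0) (if m then q else v 1)"
    "crossing (s y) (if b then u 2 else r') (if t then p else u 0) (if t then v 0 else p) (if b then r' else v 2)"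
    "crossing (s w) (if b then r' else u 2) (if m then q else u 1) (if m then v 1 else q) (if b then v 2 else r')"
    by (rule triangle_labels[OF W tc]) (rule that)
  obtain p1 q1 r1 where c:
    "crossing (s x) (if \<not> m then u 1 else q1) (if \<not> t then u 0 else p1) (if \<not> t then p1 else v 0) (if \<not> m then q1 else v 1)"
    "crossing (s y) (if \<not> b then u 2 else r1) (if \<not> t then p1 else u 0) (if \<not> t then v 0 else p1) (if \<not> b then r1 else v 2)"
    "crossing (s w) (if \<not> b then r1 else u 2) (if \<not> m then q1 else u 1) (if \<not> m then v 1 else q1) (if \<not> b then v 2 else r1)"
    using triangle_rel[OF s l] by (elim exE conjE) (rule that)
  \<comment> \<open>The branches are those of the old labels with \<open>t\<close>, \<open>m\<close>
    and \<open>b\<close> negated.\<close>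
  define i' where "i' e = (if snd e \<and> fst e = x then (if t then p1 else u 0)
      else if snd e \<and> fst e = y then (if t then u 0 else p1)
      else if snd e then (if m then u 1 else q1)
      else if fst e = x then (if m then q1 else u 1)
      else if fst e = y then (if b then r1 else u 2) else (if b then u 2 else r1))" for e
  define j' where "j' e = (if snd e \<and> fst e = x then (if t then v 0 else p1)
      else if snd e \<and> fst e = y then (if t then p1 else v 0)
      else if snd e then (if m then q1 else v 1)
      else if fst e = x then (if m then v 1 else q1)
      else if fst e = y then (if b then v 2 else r1) else (if b then r1 else v 2))" for e
  have i': "i' (x, True) = (if t then p1 else u 0)" "i' (y, True) = (if t then u 0 else p1)"
    "i' (w, True) = (if m then u 1 else q1)" "i' (x, False) = (if m then q1 else u 1)"
    "i' (y, False) = (if b then r1 else u 2)" "i' (w, False) = (if b then u 2 else r1)"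
    using d by (auto simp: i'_def)
  have j': "j' (x, True) = (if t then v 0 else p1)" "j' (y, True) = (if t then p1 else v 0)"
    "j' (w, True) = (if m then q1 else v 1)" "j' (x, False) = (if m then v 1 else q1)"
    "j' (y, False) = (if b then v 2 else r1)" "j' (w, False) = (if b then r1 else v 2)"
    using d by (auto simp: j'_def)
  have "coloured_at s' i' j' x" "coloured_at s' i' j' y" "coloured_at s' i' j' w"
    unfolding coloured_at_def i' j' using c s' by (simp_all split: if_splits)
  moreover have "W' 0 = rev (W 0)" "W' 1 = rev (W 1)" "W' 2 = rev (W 2)" using W' by simp_all
  ultimately have "tangle_coloured s' W' 3 i' j' u v"
    unfolding tangle_coloured_def all_less_1_2_3 using W by (auto simp: i' j')
  then show ?thesis by blast
qed

lemma triangle_zero: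
  assumes W: "W 0 = (if t then [(x, True), (y, True)] else [(y, True), (x, True)])"
      "W 1 = (if m then [(x, False), (w, True)] else [(w, True), (x, False)])"
      "W 2 = (if b then [(y, False), (w, False)] else [(w, False), (y, False)])"
    and s: "s x = (t = (m = r))" "s y = (t = (b = r))" "s w = (m = (b = r))"
    and tc: "tangle_coloured s W 3 i j u v" and uv: "\<forall>k<3. u k = z \<and> v k = z"
  shows "\<forall>k<3. \<forall>e\<in>set (W k). j e = z"
proof -
  have uv': "u 0 = z" "u 1 = z" "u 2 = z" "v 0 = z" "v 1 = z" "v 2 = z" using uv by auto
  obtain p1 q1 r1 where l: 
    "crossing (s x) (if m then z else q1) (if t then z else p1) (if t then p1 else z) (if m then q1 else z)"
    "crossing (s y) (if b then z else r1) (if t then p1 else z) (if t then z else p1) (if b then r1 else z)"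
    "crossing (s w) (if b then r1 else z) (if m then q1 else z) (if m then z else q1) (if b then z else r1)"
    "j (x, True) = (if t then p1 else z)" "j (y, True) = (if t then z else p1)"
    "j (x, False) = (if m then q1 else z)" "j (w, True) = (if m then z else q1)"
    "j (y, False) = (if b then r1 else z)" "j (w, False) = (if b then z else r1)"
    by (rule triangle_labels[OF W tc, unfolded uv'])
  from triangle_rel_zero[OF s l(1-3)] have "j (x, True) = z" "j (y, True) = z" "j (x, False) = z"
    "j (w, True) = z" "j (y, False) = z" "j (w, False) = z"
    using l(4-9) by simp_all
  then show ?thesis unfolding all_less_1_2_3 W by simp
qed

lemma twist_remove:
  assumes W: "W 0 = [(x, ov), (x, \<not> ov)]" and tc: "tangle_coloured s W 1 i j u v"
  shows "u 0 = v 0" "u 0 = z \<Longrightarrow> j (x, ov) = z"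
proof -
  have f: "i (x, ov) = u 0" "i (x, \<not> ov) = j (x, ov)" "j (x, \<not> ov) = v 0" "coloured_at s i j x"
    using tc unfolding tangle_coloured_def all_less_1_2_3 W by auto
  have c: "if ov then crossing (s x) (j (x, ov)) (u 0) (j (x, ov)) (v 0)
      else crossing (s x) (u 0) (j (x, ov)) (v 0) (j (x, ov))"
    using f unfolding coloured_at_def by (cases ov) auto
  show uv: "u 0 = v 0"
    using c crossing_twist(3,4) by (metis (full_types))
  show "j (x, ov) = z" if "u 0 = z"
    using c crossing_twist_zero uv that by (metis (full_types))
qed

text \<open>Negating \<open>t\<close>, \<open>m\<close> and \<open>b\<close> together leaves the
  three sign conditions unchanged, so the inverse of a third move is again a third move.\<close>

lemma reid_pattern_flip:
  fixes W W' :: "nat \<Rightarrow> gentry list"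
  assumes "\<forall>i<3. W' i = rev (W i)"
    "W 0 = (if t then [(x, True), (y, True)] else [(y, True), (x, True)])"
    "W 1 = (if m then [(x, False), (w, True)] else [(w, True), (x, False)])"
    "W 2 = (if b then [(y, False), (w, False)] else [(w, False), (y, False)])"
  shows "\<forall>i<3. W i = rev (W' i)"
    "W' 0 = (if \<not> t then [(x, True), (y, True)] else [(y, True), (x, True)])"
    "W' 1 = (if \<not> m then [(x, False), (w, True)] else [(w, True), (x, False)])"
    "W' 2 = (if \<not> b then [(y, False), (w, False)] else [(w, False), (y, False)])"
proof -
  show "\<forall>i<3. W i = rev (W' i)" using assms(1) by simp
  have "W' 0 = rev (W 0)" "W' 1 = rev (W 1)" "W' 2 = rev (W 2)" using assms(1) by simp_all
  then show "W' 0 = (if \<not> t then [(x, True), (y, True)] else [(y, True), (x, True)])"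
    "W' 1 = (if \<not> m then [(x, False), (w, True)] else [(w, True), (x, False)])"
    "W' 2 = (if \<not> b then [(y, False), (w, False)] else [(w, False), (y, False)])"
    unfolding assms(2-4) by simp_all
qed

text \<open>The disjunction covers a move and its inverse, as \<open>gd_equiv\<close> steps in both
  directions.\<close>

lemma reid_pattern_ex:
  assumes pat: "reid_pattern h W W' s s' \<or> reid_pattern h W' W s' s"
    and tc: "tangle_coloured s W h i j u v"
  shows "\<exists>i j. tangle_coloured s' W' h i j u v"
  using pat
proof
  assume "reid_pattern h W W' s s'"
  then show ?thesis
  proof (cases rule: reid_pattern_cases)
    case (R1 x ov)
    then show ?thesis using twist_insert[of W' x ov u v s'] tc
      unfolding tangle_coloured_def all_less_1_2_3 by simp
  next
    case (R2 x y)
    have "u 0 = v 0" "u 1 = v 1" using tc R2 unfolding tangle_coloured_def by (auto simp: all_less_1_2_3)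
    then show ?thesis using two_strands_insert[of x y W' s' u v] R2 by simp
  next
    case (R3 x y w t m b r)
    then show ?thesis using triangle_flip[of x y w W t m b W' s s' r i j u v] tc by blast
  qed
next
  assume "reid_pattern h W' W s' s"
  then show ?thesis
  proof (cases rule: reid_pattern_cases)
    case (R1 x ov)
    then have "u 0 = v 0" using twist_remove[of W x ov s i j u v] tc by simp
    then show ?thesis using R1 by (auto simp: tangle_coloured_def)
  next
    case (R2 x y)
    then have "u 0 = v 0 \<and> u 1 = v 1" using two_strands_remove[of W x y s i j u v] tc by blast
    then show ?thesis using R2 by (auto simp: tangle_coloured_def all_less_1_2_3)
  next
    case (R3 x y w t m b r)
    note fl = reid_pattern_flip[OF R3(6,3-5)]
    show ?thesis using triangle_flip[OF R3(2) fl(2-4,1) _ _ _ _ _ _ tc[unfolded R3(1)], of s' r] R3 by auto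
  qed
qed

lemma reid_pattern_zero:
  assumes pat: "reid_pattern h W W' s s' \<or> reid_pattern h W' W s' s"
    and tc: "tangle_coloured s W h i j u v" and uv: "\<forall>k<h. u k = z \<and> v k = z"
  shows "\<forall>k<h. \<forall>e\<in>set (W k). j e = z"
  using pat
proof
  assume "reid_pattern h W W' s s'"
  then show ?thesis
  proof (cases rule: reid_pattern_cases)
    case (R3 x y w t m b r)
    then show ?thesis using triangle_zero[OF R3(3-5) R3(10-12) tc[unfolded R3(1)]] uv by blast
  qed (auto simp: less_Suc_eq numeral_2_eq_2)
next
  assume "reid_pattern h W' W s' s"
  then show ?thesis
  proof (cases rule: reid_pattern_cases)
    case (R1 x ov)
    have "j (x, ov) = z" "j (x, \<not> ov) = z"
      using twist_remove[OF R1(3) tc[unfolded R1(1)]] uv R1 tc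
      unfolding tangle_coloured_def by (auto simp: all_less_1_2_3)
    then show ?thesis using R1 by auto
  next
    case (R2 x y)
    show ?thesis using two_strands_zero[OF R2(5-7) tc[unfolded R2(1)]] uv R2(1) by blast
  next
    case (R3 x y w t m b r)
    note fl = reid_pattern_flip[OF R3(6,3-5)]
    show ?thesis using triangle_zero[OF fl(2-4) _ _ _ tc[unfolded R3(1)], of r] R3 uv by auto
  qed
qed

lemma reid_move_colourable:
  assumes "reid_move D D'" shows "colourable D \<longleftrightarrow> colourable D'"
proof -
  obtain C W W' h where
    1: "\<forall>i<h. count_list (concat C) (Inr i) = 1" "\<forall>i. Inr i \<in> set (concat C) \<longrightarrow> i < h"
    and 2: "\<forall>i<h. \<forall>e\<in>set (W i @ W' i). \<forall>ov. Inl (fst e, ov) \<notin> set (concat C)"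
    and 3: "fst D = gd_fill W C" "fst D' = gd_fill W' C"
    and 4: "\<forall>x ov. Inl (x, ov) \<in> set (concat C) \<longrightarrow> snd D x = snd D' x"
    and pat: "reid_pattern h W W' (snd D) (snd D')"
    using assms unfolding reid_move_def by metis
  have D: "D = (gd_fill W C, snd D)" "D' = (gd_fill W' C, snd D')"
    using 3 by (metis prod.collapse)+
  have disj': "\<forall>i<h. \<forall>e\<in>set (W' i @ W i). \<forall>ov. Inl (fst e, ov) \<notin> set (concat C)"
    using 2 by auto
  have signs': "\<forall>x ov. Inl (x, ov) \<in> set (concat C) \<longrightarrow> snd D' x = snd D x"
    using 4 by auto
  have pats: "reid_pattern h W W' (snd D) (snd D') \<or> reid_pattern h W' W (snd D') (snd D)"
    "reid_pattern h W' W (snd D') (snd D) \<or> reid_pattern h W W' (snd D) (snd D')"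
    using pat by blast+
  have "colourable (gd_fill W' C, snd D')" if "colourable (gd_fill W C, snd D)"
    using colourable_replace[OF 1 2 4 reid_pattern_ex[OF pats(1)] reid_pattern_zero[OF pats(1)] that] .
  moreover have "colourable (gd_fill W C, snd D)" if "colourable (gd_fill W' C, snd D')"
    using colourable_replace[OF 1 disj' signs' reid_pattern_ex[OF pats(2)] reid_pattern_zero[OF pats(2)] that] .
  ultimately show ?thesis using D by metis
qed

section \<open>Renaming crossings, rotating words and permuting circles\<close>

lemma colourable_cong:
  assumes "set L = set L'" "\<And>x. x \<in> gd_crossings L \<Longrightarrow> s x = s' x" "colourable (L, s)"
  shows "colourable (L', s')"
proof -
  have ent: "set (concat L) = set (concat L')" using assms(1) by simp
  then have cr: "gd_crossings L = gd_crossings L'" unfolding gd_crossings_def by simp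
  obtain i j where ij: "\<forall>x\<in>gd_crossings L. coloured_at s i j x"
    "\<forall>w\<in>set L. \<exists>p. flow i j p w p" "[] \<in> set L \<or> (\<exists>e\<in>set (concat L). j e \<noteq> z)"
    using assms(3) unfolding colourable_def fst_conv snd_conv by blast
  have "\<forall>x\<in>gd_crossings L'. coloured_at s' i j x"
    using ij(1) assms(2) cr unfolding coloured_at_def by simp
  then show ?thesis using ij(2,3) ent assms(1) unfolding colourable_def fst_conv snd_conv by metis
qed

lemma image_update_rotate1:
  assumes "k < length L" "\<And>w. F (rotate1 w) = F w"
  shows "F ` set (L[k := rotate1 (L ! k)]) = F ` set L"
proof -
  have "map F (L[k := rotate1 (L ! k)]) = map F L"
    using assms by (metis list_update_id map_update)
  then show ?thesis by (metis list.set_map)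
qed

lemma colourable_rotate:
  assumes "k < length L"
  shows "colourable (L[k := rotate1 (L ! k)], s) \<longleftrightarrow> colourable (L, s)"
proof -
  let ?L = "L[k := rotate1 (L ! k)]"
  have ent: "set (concat ?L) = set (concat L)"
    unfolding set_concat using image_update_rotate1[OF assms, of set] by simp
  have "(\<forall>w\<in>set ?L. P w) \<longleftrightarrow> (\<forall>w\<in>set L. P w)" if "\<And>w. P (rotate1 w) = P w" for P
    using image_update_rotate1[of k L P, OF assms that] by (metis (mono_tags, lifting) image_iff)
  note ball = this
  have closed: "(\<forall>w\<in>set ?L. \<exists>p. flow i j p w p) \<longleftrightarrow> (\<forall>w\<in>set L. \<exists>p. flow i j p w p)" for i j
    by (rule ball) (rule closed_flow_rotate)
  have "(\<forall>w\<in>set ?L. w \<noteq> []) \<longleftrightarrow> (\<forall>w\<in>set L. w \<noteq> [])"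
    by (rule ball) simp
  then have nil: "[] \<in> set ?L \<longleftrightarrow> [] \<in> set L" by blast
  show ?thesis unfolding colourable_def fst_conv snd_conv gd_crossings_def ent closed nil ..
qed

lemma colourable_rename:
  assumes "inj_on \<phi> (gd_crossings L)"
    and "\<And>x. x \<in> gd_crossings L \<Longrightarrow> s' (\<phi> x) = s x"
  shows "colourable (map (map (\<lambda>(x, ov). (\<phi> x, ov))) L, s') \<longleftrightarrow> colourable (L, s)"
proof -
  let ?h = "\<lambda>(x, ov). (\<phi> x, ov)"
  let ?L = "map (map ?h) L"
  have ent: "set (concat ?L) = ?h ` set (concat L)" by auto
  have cr: "gd_crossings ?L = \<phi> ` gd_crossings L"
    unfolding gd_crossings_def ent by force
  show ?thesis
  proof
    assume "colourable (?L, s')"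
    then obtain i j where ij: "\<forall>x\<in>gd_crossings ?L. coloured_at s' i j x"
      "\<forall>w\<in>set ?L. \<exists>p. flow i j p w p" "[] \<in> set ?L \<or> (\<exists>e\<in>set (concat ?L). j e \<noteq> z)"
      unfolding colourable_def fst_conv snd_conv by blast
    have "\<forall>x\<in>gd_crossings L. coloured_at s (i \<circ> ?h) (j \<circ> ?h) x"
      using ij(1) assms(2) unfolding cr by (simp add: coloured_at_def)
    moreover have "\<forall>w\<in>set L. \<exists>p. flow (i \<circ> ?h) (j \<circ> ?h) p w p"
      using ij(2) by (simp add: flow_map)
    moreover have "[] \<in> set L \<or> (\<exists>e\<in>set (concat L). (j \<circ> ?h) e \<noteq> z)"
      using ij(3) unfolding ent by auto
    ultimately show "colourable (L, s)" unfolding colourable_def fst_conv snd_conv by blast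
  next
    assume "colourable (L, s)"
    then obtain i j where ij: "\<forall>x\<in>gd_crossings L. coloured_at s i j x"
      "\<forall>w\<in>set L. \<exists>p. flow i j p w p" "[] \<in> set L \<or> (\<exists>e\<in>set (concat L). j e \<noteq> z)"
      unfolding colourable_def fst_conv snd_conv by blast
    define k where "k = (\<lambda>(y, ov::bool). (inv_into (gd_crossings L) \<phi> y, ov))"
    have kh: "k (\<phi> x, ov) = (x, ov)" if "x \<in> gd_crossings L" for x ov
      using that assms(1) by (simp add: k_def)
    have kh': "k (?h e) = e" if "e \<in> set (concat L)" for e
      using that kh[of "fst e" "snd e"] unfolding gd_crossings_def by (auto simp: case_prod_beta)
    have "\<forall>x\<in>gd_crossings ?L. coloured_at s' (i \<circ> k) (j \<circ> k) x"
      using ij(1) assms(2) unfolding cr by (simp add: coloured_at_def kh)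
    moreover have "\<exists>p. flow (i \<circ> k) (j \<circ> k) p w p" if w: "w \<in> set ?L" for w
    proof -
      obtain w' where w': "w' \<in> set L" "w = map ?h w'" using w by auto
      then obtain p where "flow i j p w' p" using ij(2) by blast
      then have "flow (i \<circ> k \<circ> ?h) (j \<circ> k \<circ> ?h) p w' p"
      proof (rule flow_cong[THEN iffD1, rotated])
        fix e assume "e \<in> set w'"
        then have "e \<in> set (concat L)" using w'(1) by auto
        from kh'[OF this] show "i e = (i \<circ> k \<circ> ?h) e \<and> j e = (j \<circ> k \<circ> ?h) e" by simp
      qed
      then show ?thesis unfolding w'(2) flow_map by blast
    qed
    moreover have "[] \<in> set ?L \<or> (\<exists>e\<in>set (concat ?L). (j \<circ> k) e \<noteq> z)"
      using ij(3)
    proof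
      assume "\<exists>e\<in>set (concat L). j e \<noteq> z"
      then obtain e where "e \<in> set (concat L)" "j e \<noteq> z" by blast
      then have "?h e \<in> set (concat ?L)" "(j \<circ> k) (?h e) \<noteq> z" unfolding ent using kh' by auto
      then show ?thesis by blast
    qed force
    ultimately show "colourable (?L, s')" unfolding colourable_def fst_conv snd_conv by blast
  qed
qed

lemma gd_same_colourable:
  assumes "gd_same D D'" shows "colourable D \<longleftrightarrow> colourable D'"
proof -
  obtain L s L' s' where D: "D = (L, s)" "D' = (L', s')" by (metis prod.collapse)
  from assms[unfolded D gd_same_def fst_conv snd_conv] show ?thesis
  proof (elim disjE exE conjE)
    fix \<phi> assume "inj_on \<phi> (gd_crossings L)" "L' = map (map (\<lambda>(x, ov). (\<phi> x, ov))) L"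
      "\<forall>x\<in>gd_crossings L. s' (\<phi> x) = s x"
    then show ?thesis using colourable_rename[of \<phi> L s' s] D by simp
  next
    fix k assume s: "\<forall>x\<in>gd_crossings L. s' x = s x" and k: "k < length L" "L' = L[k := rotate1 (L ! k)]"
    then have "colourable (L, s') \<longleftrightarrow> colourable (L, s)"
      using colourable_cong[of L L s s'] colourable_cong[of L L s' s] by auto
    then show ?thesis using colourable_rotate[of k L s'] D k by simp
  next
    assume s: "\<forall>x\<in>gd_crossings L. s' x = s x" and "mset L' = mset L"
    then have L: "set L' = set L" by (metis set_mset_mset)
    then have "gd_crossings L' = gd_crossings L" unfolding gd_crossings_def by simp
    then show ?thesis using colourable_cong[of L L' s s'] colourable_cong[of L' L s' s] L s D by auto
  qed
qed

lemma gd_equiv_colourable: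
  assumes "gd_equiv D D'" shows "colourable D \<longleftrightarrow> colourable D'"
  using assms unfolding gd_equiv_def
proof (induction rule: rtranclp_induct)
  case (step D1 D2)
  have "colourable D1 \<longleftrightarrow> colourable D2"
    using step.hyps(2) gd_same_colourable[of D1 D2] gd_same_colourable[of D2 D1]
      reid_move_colourable[of D1 D2] reid_move_colourable[of D2 D1]
    unfolding gd_step_def by argo
  with step.IH show ?case by simp
qed simp

end

text \<open>Rules out that a nonempty diagram is equivalent to the empty one, which is planar but
  has no nonzero colouring.\<close>

lemma gd_equiv_length:
  assumes "gd_equiv D D'" shows "length (fst D) = length (fst D')"
  using assms unfolding gd_equiv_def
proof (induction rule: rtranclp_induct)
  case (step D1 D2)
  have "length (fst D) = length (fst D')" if "gd_same D D'" for D D'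
    using that unfolding gd_same_def by (metis length_list_update length_map size_mset)
  moreover have "length (fst D) = length (fst D')" if "reid_move D D'" for D D'
    using that unfolding reid_move_def by (metis gd_fill_conv length_map)
  ultimately show ?case using step unfolding gd_step_def by metis
qed simp

section \<open>Alexander numbering of planar diagrams\<close>

text \<open>Faces, vertices and edges will serve as indices, so the matrix fact is carried over to
  arbitrary finite index sets along enumerations.\<close>

lemma square_system_solvable:
  fixes M :: "'j \<Rightarrow> 'i \<Rightarrow> 'a::field"
  assumes "finite I" "finite J" "card I = card J"
    and inj: "\<And>x. \<forall>j\<in>J. (\<Sum>i\<in>I. M j i * x i) = 0 \<Longrightarrow> \<forall>i\<in>I. x i = 0"
  shows "\<exists>x. \<forall>j\<in>J. (\<Sum>i\<in>I. M j i * x i) = y j"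
proof -
  define n where "n = card I"
  obtain p where p: "bij_betw p {0..<n} I" using ex_bij_betw_nat_finite[OF assms(1)] n_def by auto
  obtain q where q: "bij_betw q {0..<n} J" using ex_bij_betw_nat_finite[OF assms(2)] assms(3) n_def by auto
  define p' where "p' = the_inv_into {0..<n} p"
  have p': "p' (p k) = k" if "k < n" for k
    using that p by (simp add: p'_def bij_betw_def the_inv_into_f_f)
  define N where "N = mat n n (\<lambda>(r, c). M (q r) (p c))"
  have N: "N \<in> carrier_mat n n" by (simp add: N_def)
  have sums: "(\<Sum>i\<in>I. M (q r) i * v $ p' i) = (N *\<^sub>v v) $ r" if "r < n" "v \<in> carrier_vec n" for r v
  proof -
    have "(\<Sum>i\<in>I. M (q r) i * v $ p' i) = (\<Sum>k\<in>{0..<n}. M (q r) (p k) * v $ p' (p k))"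
      by (rule sum.reindex_bij_betw[OF p, symmetric])
    also have "\<dots> = (\<Sum>k\<in>{0..<n}. M (q r) (p k) * v $ k)" by (simp add: p')
    also have "\<dots> = (N *\<^sub>v v) $ r" using that by (simp add: N_def scalar_prod_def)
    finally show ?thesis .
  qed
  have J: "\<exists>r<n. j = q r" if "j \<in> J" for j
    using that q by (auto simp: bij_betw_def image_iff)
  have I: "p k \<in> I" if "k < n" for k using that p by (auto simp: bij_betw_def)
  have "det N \<noteq> 0"
  proof
    assume "det N = 0"
    then obtain v where v: "v \<in> carrier_vec n" "v \<noteq> 0\<^sub>v n" "N *\<^sub>v v = 0\<^sub>v n"
      using det_0_iff_vec_prod_zero_field[OF N] by blast
    have "\<forall>j\<in>J. (\<Sum>i\<in>I. M j i * v $ p' i) = 0" using J sums v(1,3) by fastforce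
    from inj[OF this] have "v $ k = 0" if "k < n" for k using I[OF that] p'[OF that] by metis
    then have "v = 0\<^sub>v n" using v(1) by (intro eq_vecI) auto
    with v(2) show False ..
  qed
  define w where "w = vec n (\<lambda>r. y (q r))"
  \<comment> \<open>Cramer's rule in adjugate form.\<close>
  define v where "v = (1 / det N) \<cdot>\<^sub>v (adj_mat N *\<^sub>v w)"
  have w: "w \<in> carrier_vec n" and v: "v \<in> carrier_vec n"
    using adj_mat(1)[OF N] by (auto simp: w_def v_def)
  have one: "(det N \<cdot>\<^sub>m 1\<^sub>m n) *\<^sub>v w = det N \<cdot>\<^sub>v w"
  proof (rule eq_vecI)
    fix i assume "i < dim_vec (det N \<cdot>\<^sub>v w)"
    then have i: "i < n" using w by simp
    have "row (det N \<cdot>\<^sub>m 1\<^sub>m n) i = det N \<cdot>\<^sub>v unit_vec n i"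
      using i by (intro eq_vecI) auto
    then show "((det N \<cdot>\<^sub>m 1\<^sub>m n) *\<^sub>v w) $ i = (det N \<cdot>\<^sub>v w) $ i"
      using i w by simp
  qed (use w in simp)
  have "N *\<^sub>v v = (1 / det N) \<cdot>\<^sub>v (N *\<^sub>v (adj_mat N *\<^sub>v w))"
    unfolding v_def using adj_mat(1)[OF N] w by (intro mult_mat_vec[OF N]) auto
  also have "N *\<^sub>v (adj_mat N *\<^sub>v w) = det N \<cdot>\<^sub>v w"
    using assoc_mult_mat_vec[OF N adj_mat(1)[OF N] w] adj_mat(2)[OF N] one by simp
  finally have Nv: "N *\<^sub>v v = w" using \<open>det N \<noteq> 0\<close> w by (simp add: smult_smult_assoc)
  have "(\<Sum>i\<in>I. M j i * v $ p' i) = y j" if j: "j \<in> J" for j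
  proof -
    obtain r where "r < n" "j = q r" using J[OF j] by blast
    then show ?thesis using sums[OF _ v, of r] Nv by (simp add: w_def)
  qed
  then show ?thesis by (intro exI[of _ "\<lambda>i. v $ p' i"]) blast
qed

text \<open>Faces are defined by forward iteration only. An injective self-map of a finite set is a
  permutation, so iteration returns to \<open>d\<close> and the forward orbit is a full
  cycle.\<close>

lemma funpow_orbit_step:
  assumes "finite D" "\<And>d. d \<in> D \<Longrightarrow> h d \<in> D" "inj_on h D" "d \<in> D"
  shows "{d'. \<exists>k. (h ^^ k) (h d) = d'} = {d'. \<exists>k. (h ^^ k) d = d'}"
proof -
  have in_D: "(h ^^ k) d \<in> D" for k by (induction k) (use assms in auto)
  have "\<not> inj (\<lambda>k. (h ^^ k) d)"
    using assms(1) in_D by (metis finite_subset image_subsetI infinite_UNIV_nat finite_imageD)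
  then obtain k l where kl: "k < l" "(h ^^ k) d = (h ^^ l) d"
    unfolding inj_def by (metis linorder_neqE_nat)
  have "(h ^^ m) d = (h ^^ (n + m)) d \<Longrightarrow> d = (h ^^ n) d" for n m
  proof (induction m)
    case (Suc m)
    then have "h ((h ^^ m) d) = h ((h ^^ (n + m)) d)" by simp
    then show ?case using Suc.IH in_D assms(3) by (metis inj_onD)
  qed simp
  from this[of k "l - k"] kl have "d = (h ^^ (l - k)) d" by simp
  then obtain n where n: "d = (h ^^ n) (h d)"
    using kl(1) by (metis Suc_diff_Suc funpow_Suc_right comp_apply)
  show ?thesis
  proof (intro equalityI subsetI; clarsimp)
    show "\<exists>l. (h ^^ l) d = (h ^^ k) (h d)" for k
      by (rule exI[of _ "Suc k"]) (simp add: funpow_swap1)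
    show "\<exists>l. (h ^^ l) (h d) = (h ^^ k) d" for k
      by (rule exI[of _ "k + n"]) (use n in \<open>simp add: funpow_add\<close>)
  qed
qed

text \<open>The orbit of a dart \<open>d\<close> under \<open>\<rho> \<circ> \<alpha>\<close> is the face to the right of \<open>d\<close>; the face to its left is
  that of \<open>\<alpha> d\<close>, which is also that of \<open>\<rho> d\<close>.\<close>

lemma planar_potential:
  fixes \<alpha> \<rho> \<tau> :: "'d \<Rightarrow> 'd" and vt :: "'d \<Rightarrow> 'v" and out :: "'d \<Rightarrow> bool"
  defines "orb \<equiv> \<lambda>d. {d'. \<exists>k. ((\<rho> \<circ> \<alpha>) ^^ k) d = d'}"
  assumes fin: "finite D"
    and \<alpha>: "\<And>d. d \<in> D \<Longrightarrow> \<alpha> d \<in> D" "\<And>d. d \<in> D \<Longrightarrow> \<alpha> (\<alpha> d) = d" "\<And>d. d \<in> D \<Longrightarrow> out (\<alpha> d) \<longleftrightarrow> \<not> out d"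
    and \<rho>: "\<And>d. d \<in> D \<Longrightarrow> \<rho> d \<in> D" "inj_on \<rho> D" "\<And>d. d \<in> D \<Longrightarrow> vt (\<rho> d) = vt d"
    and \<tau>: "\<And>d. d \<in> D \<Longrightarrow> \<tau> d \<in> D" "\<And>d. d \<in> D \<Longrightarrow> \<tau> (\<tau> d) = d" "\<And>d. d \<in> D \<Longrightarrow> out (\<tau> d) \<longleftrightarrow> \<not> out d"
       "\<And>d. d \<in> D \<Longrightarrow> vt (\<tau> d) = vt d"
    and R: "R = {(d, d'). d \<in> D \<and> (d' = \<rho> d \<or> d' = \<alpha> d)}"
    and vtR: "\<And>d d'. d \<in> D \<Longrightarrow> d' \<in> D \<Longrightarrow> vt d = vt d' \<Longrightarrow> (d, d') \<in> R\<^sup>*"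
    and euler: "card (orb ` D) + card (vt ` D) = card {d \<in> D. out d} + 2 * card (D // R\<^sup>*)"
  shows "\<exists>H::'d \<Rightarrow> int. \<forall>d\<in>D. H (\<rho> d) = H (\<alpha> d) \<and> H (\<rho> d) = H d + (if out d then 1 else - 1)"
proof -
  define Out where "Out = {d \<in> D. out d}"
  have Out: "finite Out" "\<And>d. d \<in> Out \<Longrightarrow> d \<in> D" and OutD: "Out \<subseteq> D"
    using fin by (auto simp: Out_def)
  \<comment> \<open>As \<alpha> is an involution, \<open>\<rho> d\<close> is the image of
    \<open>\<alpha> d\<close> under \<open>\<rho> \<circ> \<alpha>\<close>.\<close>
  have orb_\<alpha>: "orb (\<rho> d) = orb (\<alpha> d)" if "d \<in> D" for d
  proof -
    have "inj_on (\<rho> \<circ> \<alpha>) D"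
      by (rule comp_inj_on[OF _ inj_on_subset[OF \<rho>(2)]]) (use \<alpha> in \<open>auto intro: inj_on_inverseI\<close>)
    from funpow_orbit_step[OF fin _ this \<alpha>(1)[OF that]] \<alpha> \<rho>(1) that
    show ?thesis by (simp add: orb_def)
  qed
  have R_step: "(d, \<rho> d) \<in> R\<^sup>*" "(d, \<alpha> d) \<in> R\<^sup>*" if "d \<in> D" for d
    using that by (auto simp: R)
  have orb_R: "(d, d') \<in> R\<^sup>*" if "d \<in> D" "orb d = orb d'" for d d'
  proof -
    have "(d, ((\<rho> \<circ> \<alpha>) ^^ k) d) \<in> R\<^sup>* \<and> ((\<rho> \<circ> \<alpha>) ^^ k) d \<in> D" for k
    proof (induction k)
      case (Suc k)
      define e where "e = ((\<rho> \<circ> \<alpha>) ^^ k) d"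
      have e: "(d, e) \<in> R\<^sup>*" "e \<in> D" using Suc unfolding e_def by blast+
      then have "(d, \<rho> (\<alpha> e)) \<in> R\<^sup>*" "\<rho> (\<alpha> e) \<in> D"
        using R_step(2)[of e] R_step(1)[of "\<alpha> e"] \<alpha>(1) \<rho>(1) by (auto intro: rtrancl_trans)
      moreover have "((\<rho> \<circ> \<alpha>) ^^ Suc k) d = \<rho> (\<alpha> e)"
        by (simp only: funpow.simps comp_apply e_def)
      ultimately show ?case by metis
    qed (use that in simp)
    note reach = this
    have "d' \<in> orb d'" unfolding orb_def by (auto intro: exI[of _ 0])
    then have "d' \<in> orb d" using that(2) by simp
    then obtain k where "((\<rho> \<circ> \<alpha>) ^^ k) d = d'" unfolding orb_def by blast
    with reach[of k] show ?thesis by metis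
  qed
  have bij_\<rho>: "bij_betw \<rho> D D"
    using \<rho>(1,2) fin by (metis bij_betw_def endo_inj_surj image_subsetI)
  have flip: "sum h Out = sum (\<lambda>d. h (\<sigma> d)) (D - Out)" "sum h (D - Out) = sum (\<lambda>d. h (\<sigma> d)) Out"
    if "\<And>d. d \<in> D \<Longrightarrow> \<sigma> d \<in> D" "\<And>d. d \<in> D \<Longrightarrow> \<sigma> (\<sigma> d) = d" "\<And>d. d \<in> D \<Longrightarrow> out (\<sigma> d) \<longleftrightarrow> \<not> out d"
    for h :: "'d \<Rightarrow> real" and \<sigma>
    using that by (auto intro!: sum.reindex_bij_witness[of _ \<sigma> \<sigma>] simp: Out_def)
  \<comment> \<open>Face boundaries are orthogonal to vertex coboundaries: regrouped by darts
    instead of edges, the face values telescope along \<rho> around each vertex, where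
    \<open>b\<close> is constant.\<close>
  have orth: "(\<Sum>d\<in>Out. (a (orb (\<alpha> d)) - a (orb d)) * (b (vt (\<alpha> d)) - b (vt d))) = 0"
    for a :: "'d set \<Rightarrow> real" and b
  proof -
    define g where "g d = a (orb (\<alpha> d)) - a (orb d)" for d
    have "(\<Sum>d\<in>Out. g d * b (vt (\<alpha> d))) = (\<Sum>d\<in>Out. - (g (\<alpha> d) * b (vt (\<alpha> d))))"
      by (rule sum.cong) (use Out \<alpha> in \<open>auto simp: g_def algebra_simps\<close>)
    also have "\<dots> = - (\<Sum>d\<in>D - Out. g d * b (vt d))"
      using flip(2)[OF \<alpha>, of "\<lambda>d. g d * b (vt d)"] by (simp add: sum_negf)
    finally have "(\<Sum>d\<in>Out. g d * (b (vt (\<alpha> d)) - b (vt d))) =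
        - ((\<Sum>d\<in>D - Out. g d * b (vt d)) + (\<Sum>d\<in>Out. g d * b (vt d)))"
      by (simp add: right_diff_distrib sum_subtractf)
    also have "\<dots> = - (\<Sum>d\<in>D. g d * b (vt d))"
      using sum.subset_diff[OF OutD fin, of "\<lambda>d. g d * b (vt d)"] by simp
    finally have 1: "(\<Sum>d\<in>Out. g d * (b (vt (\<alpha> d)) - b (vt d))) = - (\<Sum>d\<in>D. g d * b (vt d))" .
    have "(\<Sum>d\<in>D. g d * b (vt d)) =
        (\<Sum>d\<in>D. a (orb (\<rho> d)) * b (vt (\<rho> d))) - (\<Sum>d\<in>D. a (orb d) * b (vt d))"
      by (simp add: g_def left_diff_distrib sum_subtractf orb_\<alpha> \<rho>(3) cong: sum.cong)
    also have "\<dots> = 0"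
      using sum.reindex_bij_betw[OF bij_\<rho>, of "\<lambda>d. a (orb d) * b (vt d)"] by simp
    finally show ?thesis using 1 by (simp add: g_def)
  qed
  \<comment> \<open>The all-one edge function is orthogonal to vertex coboundaries too, because
    \<tau> pairs the ingoing with the outgoing darts at each vertex.\<close>
  have orth1: "(\<Sum>d\<in>Out. b (vt (\<alpha> d)) - b (vt d)) = 0" for b :: "'v \<Rightarrow> real"
  proof -
    have "(\<Sum>d\<in>Out. b (vt (\<alpha> d))) = (\<Sum>d\<in>D - Out. b (vt d))"
      using flip(2)[OF \<alpha>, of "\<lambda>d. b (vt d)"] by simp
    also have "\<dots> = (\<Sum>d\<in>Out. b (vt (\<tau> d)))"
      using flip(2)[OF \<tau>(1-3), of "\<lambda>d. b (vt d)"] by simp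
    also have "\<dots> = (\<Sum>d\<in>Out. b (vt d))" using Out(2) \<tau>(4) by simp
    finally show ?thesis by (simp add: sum_subtractf)
  qed
  \<comment> \<open>The potentials are normalised to vanish on one face and one vertex per component;
    Euler's formula makes the remaining system for the edges square.\<close>
  define rep where "rep c = (SOME d. d \<in> D \<and> c = R\<^sup>* `` {d})" for c
  have rep: "rep c \<in> D" "R\<^sup>* `` {rep c} = c" if "c \<in> D // R\<^sup>*" for c
  proof -
    have "\<exists>d. d \<in> D \<and> c = R\<^sup>* `` {d}" using that by (auto elim: quotientE)
    from someI_ex[OF this] show "rep c \<in> D" "R\<^sup>* `` {rep c} = c" by (auto simp: rep_def)
  qed
  have const: "h d = h (rep (R\<^sup>* `` {d}))"
    if h: "\<And>d. d \<in> D \<Longrightarrow> h (\<rho> d) = h d \<and> h (\<alpha> d) = h d" and "d \<in> D" for h :: "'d \<Rightarrow> real" and d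
  proof -
    have "h e = h r" if "(r, e) \<in> R\<^sup>*" for r e
      using that by induction (use h in \<open>auto simp: R\<close>)
    moreover have "(rep (R\<^sup>* `` {d}), d) \<in> R\<^sup>*"
      using rep(2)[of "R\<^sup>* `` {d}"] that(2) by (auto intro: quotientI)
    ultimately show ?thesis by blast
  qed
  define F where "F = orb ` D - (\<lambda>c. orb (rep c)) ` (D // R\<^sup>*)"
  define V where "V = vt ` D - (\<lambda>c. vt (rep c)) ` (D // R\<^sup>*)"
  have finC: "finite (D // R\<^sup>*)" using fin by (simp add: quotient_def)
  have finF: "finite F" "finite V" using fin by (simp_all add: F_def V_def)
  have inj_rep: "c = c'" if "c \<in> D // R\<^sup>*" "c' \<in> D // R\<^sup>*" "(rep c, rep c') \<in> R\<^sup>*" "(rep c', rep c) \<in> R\<^sup>*" for c c'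
  proof -
    have "R\<^sup>* `` {rep c} = R\<^sup>* `` {rep c'}" using that(3,4) by (auto intro: rtrancl_trans)
    then show ?thesis using rep(2) that(1,2) by metis
  qed
  \<comment> \<open>A face or a vertex determines its component, so the normalisation removes
    exactly one face and one vertex per component.\<close>
  have inj_orb: "inj_on (\<lambda>c. orb (rep c)) (D // R\<^sup>*)"
  proof (rule inj_onI)
    fix c c' assume c: "c \<in> D // R\<^sup>*" "c' \<in> D // R\<^sup>*" and "orb (rep c) = orb (rep c')"
    then show "c = c'" using inj_rep[OF c] orb_R rep(1)[OF c(1)] rep(1)[OF c(2)] by metis
  qed
  have inj_vt: "inj_on (\<lambda>c. vt (rep c)) (D // R\<^sup>*)"
  proof (rule inj_onI)
    fix c c' assume c: "c \<in> D // R\<^sup>*" "c' \<in> D // R\<^sup>*" and "vt (rep c) = vt (rep c')"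
    then show "c = c'" using inj_rep[OF c] vtR rep(1)[OF c(1)] rep(1)[OF c(2)] by metis
  qed
  have sub: "(\<lambda>c. orb (rep c)) ` (D // R\<^sup>*) \<subseteq> orb ` D" "(\<lambda>c. vt (rep c)) ` (D // R\<^sup>*) \<subseteq> vt ` D"
    using rep(1) by blast+
  have "card F = card (orb ` D) - card (D // R\<^sup>*)"
    unfolding F_def using finC card_image[OF inj_orb] sub(1) by (simp add: card_Diff_subset)
  moreover have "card V = card (vt ` D) - card (D // R\<^sup>*)"
    unfolding V_def using finC card_image[OF inj_vt] sub(2) by (simp add: card_Diff_subset)
  moreover have "card (D // R\<^sup>*) \<le> card (orb ` D)" "card (D // R\<^sup>*) \<le> card (vt ` D)"
    using card_inj_on_le[OF inj_orb sub(1)] card_inj_on_le[OF inj_vt sub(2)] fin by simp_all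
  ultimately have card: "card (F <+> V) = card Out"
    using euler finF by (simp add: card_Plus Out_def)
  define M where "M d i = (case i of Inl \<phi> \<Rightarrow> of_bool (\<phi> = orb (\<alpha> d)) - of_bool (\<phi> = orb d)
      | Inr v \<Rightarrow> of_bool (v = vt (\<alpha> d)) - (of_bool (v = vt d) :: real))" for d i
  define a where "a x \<phi> = (if \<phi> \<in> F then x (Inl \<phi>) else 0)" for x :: "'d set + 'v \<Rightarrow> real" and \<phi>
  define b where "b x v = (if v \<in> V then x (Inr v) else 0)" for x :: "'d set + 'v \<Rightarrow> real" and v
  have sys: "(\<Sum>i\<in>F <+> V. M d i * x i) =
      (a x (orb (\<alpha> d)) - a x (orb d)) + (b x (vt (\<alpha> d)) - b x (vt d))" for x d
    using finF by (simp add: sum.Plus M_def left_diff_distrib sum_subtractf a_def b_def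
        of_bool_def if_distrib[of "\<lambda>u. u * _"] sum.delta' cong: if_cong)
  \<comment> \<open>If \<open>B = - A\<close> and \<open>A\<close> is orthogonal to
    \<open>B\<close>, then over the reals \<open>A\<close> has norm zero. Both potentials are then
    constant on components, hence zero by normalisation.\<close>
  have zero: "\<forall>i\<in>F <+> V. x i = 0" if x: "\<forall>d\<in>Out. (\<Sum>i\<in>F <+> V. M d i * x i) = 0" for x
  proof -
    define A where "A d = a x (orb (\<alpha> d)) - a x (orb d)" for d
    define B where "B d = b x (vt (\<alpha> d)) - b x (vt d)" for d
    have AB: "B d = - A d" if "d \<in> Out" for d
      using x that unfolding sys A_def[symmetric] B_def[symmetric] by fastforce
    have "(\<Sum>d\<in>Out. (A d)\<^sup>2) = - (\<Sum>d\<in>Out. A d * B d)"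
      unfolding sum_negf[symmetric] by (rule sum.cong) (simp_all add: AB power2_eq_square)
    also have "\<dots> = 0" using orth[of "a x" "b x"] by (simp add: A_def B_def)
    finally have "\<forall>d\<in>Out. A d = 0"
      using Out(1) by (simp add: sum_nonneg_eq_0_iff)
    then have 0: "A d = 0 \<and> B d = 0" if "d \<in> Out" for d using AB that by force
    have 1: "A d = 0 \<and> B d = 0" if "d \<in> D" for d
    proof (cases "out d")
      case True
      then show ?thesis using 0 that by (simp add: Out_def)
    next
      case False
      then show ?thesis using 0[of "\<alpha> d"] \<alpha> that by (simp add: Out_def A_def B_def)
    qed
    have "a x (orb d) = 0" if "d \<in> D" for d
    proof -
      have "a x (orb d) = a x (orb (rep (R\<^sup>* `` {d})))"
        using const[of "\<lambda>d. a x (orb d)" d] 1 orb_\<alpha> that by (simp add: A_def)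
      also have "\<dots> = 0" using that unfolding a_def F_def by (auto intro: quotientI)
      finally show ?thesis .
    qed
    moreover have "b x (vt d) = 0" if "d \<in> D" for d
    proof -
      have "b x (vt d) = b x (vt (rep (R\<^sup>* `` {d})))"
        using const[of "\<lambda>d. b x (vt d)" d] 1 \<rho>(3) that by (simp add: B_def)
      also have "\<dots> = 0" using that unfolding b_def V_def by (auto intro: quotientI)
      finally show ?thesis .
    qed
    moreover have "\<exists>d\<in>D. \<phi> = orb d" if "\<phi> \<in> F" for \<phi> using that by (auto simp: F_def)
    moreover have "\<exists>d\<in>D. v = vt d" if "v \<in> V" for v using that by (auto simp: V_def)
    ultimately have "x (Inl \<phi>) = 0" if "\<phi> \<in> F" for \<phi>
      using that by (metis a_def)
    moreover have "x (Inr v) = 0" if "v \<in> V" for v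
      using that \<open>\<And>d. d \<in> D \<Longrightarrow> b x (vt d) = 0\<close> \<open>\<And>v. v \<in> V \<Longrightarrow> \<exists>d\<in>D. v = vt d\<close> by (metis b_def)
    ultimately show ?thesis by auto
  qed
  \<comment> \<open>The constant 1 splits into a face part \<open>A\<close> and a vertex part
    \<open>B\<close>. As \<open>B\<close> is orthogonal to \<open>A\<close> and to 1, it is
    orthogonal to itself and vanishes, so the face numbers jump by 1 across every edge.\<close>
  obtain x where x: "\<forall>d\<in>Out. (\<Sum>i\<in>F <+> V. M d i * x i) = 1"
    using square_system_solvable[of "F <+> V" Out M "\<lambda>_. 1"] finF Out(1) card zero by auto
  define A where "A d = a x (orb (\<alpha> d)) - a x (orb d)" for d
  define B where "B d = b x (vt (\<alpha> d)) - b x (vt d)" for d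
  have AB: "A d = 1 - B d" if "d \<in> Out" for d
    using x that unfolding sys A_def[symmetric] B_def[symmetric] by fastforce
  have "(\<Sum>d\<in>Out. (B d)\<^sup>2) = (\<Sum>d\<in>Out. B d - A d * B d)"
    by (rule sum.cong) (simp_all add: AB power2_eq_square algebra_simps)
  also have "\<dots> = 0"
    using orth[of "a x" "b x"] orth1[of "b x"] by (simp only: sum_subtractf A_def[symmetric] B_def[symmetric] diff_self)
  finally have "\<forall>d\<in>Out. B d = 0" using Out(1) by (simp add: sum_nonneg_eq_0_iff)
  then have A1: "a x (orb (\<alpha> d)) = a x (orb d) + 1" if "d \<in> Out" for d
    using AB[OF that] that by (simp add: A_def)
  \<comment> \<open>The face numbers are real so far. Rounding down commutes with adding 1 and thus
    gives integers with the same jumps.\<close>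
  show ?thesis
  proof (intro exI[of _ "\<lambda>d. \<lfloor>a x (orb d)\<rfloor>"] ballI conjI)
    fix d assume d: "d \<in> D"
    show "\<lfloor>a x (orb (\<rho> d))\<rfloor> = \<lfloor>a x (orb (\<alpha> d))\<rfloor>" using orb_\<alpha>[OF d] by simp
    show "\<lfloor>a x (orb (\<rho> d))\<rfloor> = \<lfloor>a x (orb d)\<rfloor> + (if out d then 1 else - 1)"
    proof (cases "out d")
      case True
      then show ?thesis using A1[of d] orb_\<alpha>[OF d] d by (simp add: Out_def)
    next
      case False
      then show ?thesis using A1[of "\<alpha> d"] orb_\<alpha>[OF d] d \<alpha> by (simp add: Out_def)
    qed
  qed
qed

section \<open>Cyclic order in Gauss diagrams and the faces of a planar diagram\<close>

lemma distinct_if_count_le_1: "(\<And>x. count_list xs x \<le> 1) \<Longrightarrow> distinct xs"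
proof (induction xs)
  case (Cons a xs)
  have "count_list xs x \<le> 1" for x using Cons.prems[of x] by (auto split: if_splits)
  moreover have "a \<notin> set xs" using Cons.prems[of a] by (simp add: count_list_0_iff)
  ultimately show ?case using Cons.IH by simp
qed simp

lemma gd_wf_distinct:
  assumes "gd_wf (L, s)" shows "distinct (concat L)"
proof (rule distinct_if_count_le_1)
  show "count_list (concat L) x \<le> 1" for x
    using assms unfolding gd_wf_def by (cases x; cases "snd x") auto
qed

lemma gd_wf_entries:
  assumes "gd_wf (L, s)" shows "set (concat L) = gd_crossings L \<times> UNIV"
proof -
  have "(x, True) \<in> set (concat L) \<longleftrightarrow> (x, False) \<in> set (concat L)" for x
    using assms unfolding gd_wf_def by (metis count_list_0_iff fst_conv)
  then have "(x, ov) \<in> set (concat L) \<longleftrightarrow> (\<exists>ov. (x, ov) \<in> set (concat L))" for x ov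
    by (metis (full_types))
  moreover have "x \<in> gd_crossings L \<longleftrightarrow> (\<exists>ov. (x, ov) \<in> set (concat L))" for x
    unfolding gd_crossings_def by force
  ultimately have "(x, ov) \<in> set (concat L) \<longleftrightarrow> x \<in> gd_crossings L" for x ov by metis
  then show ?thesis by (metis SigmaE SigmaI UNIV_I subrelI subset_antisym)
qed

lemma entry_position_unique:
  assumes "distinct (concat L)" "xs \<in> set L" "ys \<in> set L" "i < length xs" "j < length ys" "xs ! i = ys ! j"
  shows "xs = ys \<and> i = j"
proof -
  have "xs = ys"
    using assms unfolding distinct_concat_iff by (metis disjoint_iff nth_mem)
  then show ?thesis using assms unfolding distinct_concat_iff by (metis nth_eq_iff_index_eq)
qed

lemma gd_succ_nth:
  assumes "distinct (concat L)" "xs \<in> set L" "i < length xs"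
  shows "gd_succ L (xs ! i) = xs ! (Suc i mod length xs)"
  unfolding gd_succ_def
proof (rule the_equality)
  show "\<exists>ys\<in>set L. \<exists>j<length ys. ys ! j = xs ! i \<and> xs ! (Suc i mod length xs) = ys ! (Suc j mod length ys)"
    using assms(2,3) by blast
next
  fix e' assume "\<exists>ys\<in>set L. \<exists>j<length ys. ys ! j = xs ! i \<and> e' = ys ! (Suc j mod length ys)"
  then obtain ys j where ys: "ys \<in> set L" "j < length ys" "ys ! j = xs ! i" "e' = ys ! (Suc j mod length ys)"
    by blast
  have "ys = xs \<and> j = i" by (rule entry_position_unique[OF assms(1) ys(1) assms(2) ys(2) assms(3) ys(3)])
  then show "e' = xs ! (Suc i mod length xs)" using ys(4) by simp
qed

lemma gd_pred_nth:
  assumes "distinct (concat L)" "xs \<in> set L" "i < length xs"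
  shows "gd_pred L (xs ! i) = xs ! ((i + length xs - 1) mod length xs)"
  unfolding gd_pred_def
proof (rule the_equality)
  show "\<exists>ys\<in>set L. \<exists>j<length ys. ys ! j = xs ! i \<and> xs ! ((i + length xs - 1) mod length xs) = ys ! ((j + length ys - 1) mod length ys)"
    using assms(2,3) by blast
next
  fix e' assume "\<exists>ys\<in>set L. \<exists>j<length ys. ys ! j = xs ! i \<and> e' = ys ! ((j + length ys - 1) mod length ys)"
  then obtain ys j where ys: "ys \<in> set L" "j < length ys" "ys ! j = xs ! i" "e' = ys ! ((j + length ys - 1) mod length ys)"
    by blast
  have "ys = xs \<and> j = i" by (rule entry_position_unique[OF assms(1) ys(1) assms(2) ys(2) assms(3) ys(3)])
  then show "e' = xs ! ((i + length xs - 1) mod length xs)" using ys(4) by simp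
qed

lemma entry_position:
  assumes "e \<in> set (concat L)"
  obtains xs i where "xs \<in> set L" "i < length xs" "e = xs ! i"
proof -
  obtain xs where "xs \<in> set L" "e \<in> set xs" using assms unfolding set_concat by blast
  then show thesis using that by (metis in_set_conv_nth)
qed

lemma gd_succ_pred:
  assumes "distinct (concat L)" "e \<in> set (concat L)"
  shows "gd_succ L e \<in> set (concat L)" "gd_pred L e \<in> set (concat L)"
    "gd_pred L (gd_succ L e) = e" "gd_succ L (gd_pred L e) = e"
proof -
  obtain xs i where xs: "xs \<in> set L" "i < length xs" "e = xs ! i"
    using entry_position[OF assms(2)] .
  let ?n = "length xs"
  have m: "Suc i mod ?n < ?n" "(i + ?n - 1) mod ?n < ?n"
    using xs(2) by (auto intro!: mod_less_divisor)
  have in_L: "xs ! k \<in> set (concat L)" if "k < ?n" for k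
    unfolding set_concat using xs(1) that nth_mem by blast
  note s = gd_succ_nth[OF assms(1) xs(1)] and p = gd_pred_nth[OF assms(1) xs(1)]
  show "gd_succ L e \<in> set (concat L)" "gd_pred L e \<in> set (concat L)"
    using s[OF xs(2)] p[OF xs(2)] in_L[OF m(1)] in_L[OF m(2)] xs(3) by simp_all
  have "(Suc i mod ?n + ?n - 1) mod ?n = i"
    using xs(2) by (cases "Suc i = ?n") auto
  then show "gd_pred L (gd_succ L e) = e" using s[OF xs(2)] p[OF m(1)] xs(3) by simp
  have "Suc ((i + ?n - 1) mod ?n) mod ?n = i"
    using xs(2) by (cases i) auto
  then show "gd_succ L (gd_pred L e) = e" using p[OF xs(2)] s[OF m(2)] xs(3) by simp
qed

lemma gd_rot_simps:
  "s x \<Longrightarrow> gd_rot s (x, False, False) = (x, True, True)"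
  "s x \<Longrightarrow> gd_rot s (x, True, True) = (x, False, True)"
  "s x \<Longrightarrow> gd_rot s (x, False, True) = (x, True, False)"
  "s x \<Longrightarrow> gd_rot s (x, True, False) = (x, False, False)"
  "\<not> s x \<Longrightarrow> gd_rot s (x, False, False) = (x, True, False)"
  "\<not> s x \<Longrightarrow> gd_rot s (x, True, False) = (x, False, True)"
  "\<not> s x \<Longrightarrow> gd_rot s (x, False, True) = (x, True, True)"
  "\<not> s x \<Longrightarrow> gd_rot s (x, True, True) = (x, False, False)"
  unfolding gd_rot_def by auto

text \<open>Edges are counted by their outgoing darts, so there are twice as many edges as crossings
  and \<open>gd_classical\<close> turns into Euler's formula. The involution \<tau> exchanges the
  two darts of one passage.\<close>

lemma gd_classical_potential:
  assumes "gd_classical (L, s)"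
  shows "\<exists>H::nat \<times> bool \<times> bool \<Rightarrow> int. \<forall>d\<in>gd_darts L. H (gd_rot s d) = H (gd_alpha L d) \<and>
           H (gd_rot s d) = H d + (if snd (snd d) then 1 else - 1)"
proof -
  let ?D = "gd_darts L" and ?X = "gd_crossings L"
  let ?R = "{(d, d'). d \<in> ?D \<and> (d' = gd_rot s d \<or> d' = gd_alpha L d)}"
  have wf: "gd_wf (L, s)"
    and euler: "card ((\<lambda>d. {d'. \<exists>k. ((gd_rot s \<circ> gd_alpha L) ^^ k) d = d'}) ` ?D) =
      card ?X + 2 * card (?D // ?R\<^sup>*)"
    using assms unfolding gd_classical_def gd_num_faces_def gd_num_components_def by auto
  have dist: "distinct (concat L)" by (rule gd_wf_distinct[OF wf])
  have X: "x \<in> ?X \<longleftrightarrow> (x, ov) \<in> set (concat L)" for x ov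
    using gd_wf_entries[OF wf] by auto
  have D: "?D = ?X \<times> UNIV" by (auto simp: gd_darts_def)
  have finX: "finite ?X" by (simp add: gd_crossings_def)
  show ?thesis
  proof (rule planar_potential[where \<tau> = "\<lambda>(x, ov, out). (x, ov, \<not> out)" and vt = fst and R = ?R])
    show "finite ?D" using finX by (simp add: D)
    show "gd_alpha L d \<in> ?D" "gd_alpha L (gd_alpha L d) = d"
      "snd (snd (gd_alpha L d)) \<longleftrightarrow> \<not> snd (snd d)" if dD: "d \<in> ?D" for d
    proof -
      obtain x ov out where d: "d = (x, ov, out)" by (metis prod.collapse)
      have e: "(x, ov) \<in> set (concat L)" using dD X[of x ov] unfolding D d by simp
      note sp = gd_succ_pred[OF dist e]
      have "fst (gd_succ L (x, ov)) \<in> ?X" "fst (gd_pred L (x, ov)) \<in> ?X"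
        using sp(1,2) unfolding gd_crossings_def by blast+
      then show "gd_alpha L d \<in> ?D" by (simp add: gd_alpha_def d D)
      show "gd_alpha L (gd_alpha L d) = d" "snd (snd (gd_alpha L d)) \<longleftrightarrow> \<not> snd (snd d)"
        using sp(3,4) by (simp_all add: gd_alpha_def d)
    qed
    show "gd_rot s d \<in> ?D" "fst (gd_rot s d) = fst d" if "d \<in> ?D" for d
      using that by (auto simp: D gd_rot_def split: prod.splits)
    have rot4: "gd_rot s (gd_rot s (gd_rot s (gd_rot s d))) = d" for d
      by (auto simp: gd_rot_def split: prod.splits)
    then show "inj_on (gd_rot s) ?D" by (metis inj_onI)
    \<comment> \<open>The rotation is a 4-cycle on the darts of a crossing, so at most three turns
      lead from \<open>d\<close> to \<open>d'\<close>.\<close>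
    show "(d, d') \<in> ?R\<^sup>*" if "d \<in> ?D" "d' \<in> ?D" "fst d = fst d'" for d d'
    proof -
      have D': "gd_rot s e \<in> ?D" if "e \<in> ?D" for e
        using that by (auto simp: D gd_rot_def split: prod.splits)
      have st: "(d, gd_rot s e) \<in> ?R\<^sup>* \<and> gd_rot s e \<in> ?D" if "(d, e) \<in> ?R\<^sup>* \<and> e \<in> ?D" for e
        using that D' by (auto intro: rtrancl_into_rtrancl)
      have 0: "(d, d) \<in> ?R\<^sup>* \<and> d \<in> ?D" using that by simp
      note 1 = st[OF 0] note 2 = st[OF 1] note 3 = st[OF 2]
      have "d' \<in> {d, gd_rot s d, gd_rot s (gd_rot s d), gd_rot s (gd_rot s (gd_rot s d))}"
        using that(3) by (cases d; cases d') (auto simp: gd_rot_def)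
      then show ?thesis using 0 1 2 3 by (elim insertE) (simp_all only: empty_iff)
    qed
    have "{d \<in> ?D. snd (snd d)} = (\<lambda>(x, ov). (x, ov, True)) ` (?X \<times> UNIV)" by (force simp: D)
    then have "card {d \<in> ?D. snd (snd d)} = card (?X \<times> (UNIV :: bool set))"
      by (simp add: card_image inj_on_def)
    moreover have "fst ` ?D = ?X" by (auto simp: D image_iff)
    ultimately show "card ((\<lambda>d. {d'. \<exists>k. ((gd_rot s \<circ> gd_alpha L) ^^ k) d = d'}) ` ?D) + card (fst ` ?D) =
        card {d \<in> ?D. snd (snd d)} + 2 * card (?D // ?R\<^sup>*)"
      unfolding euler by (simp add: card_cartesian_product)
  qed (auto simp: D)
qed

section \<open>Colouring a planar diagram by its face numbers\<close>

context switch begin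

text \<open>Stands for the powers of the unit on a nonzero vector. Face numbers may be negative, so
  the sequence is continued to the left by a second map: \<open>T\<close> comes from
  \<open>f_surj\<close>, \<open>U\<close> from \<open>g_surj\<close>, and by \<open>fix_iff\<close>
  each step satisfies both equations.\<close>

lemma fixed_sequence: "\<exists>t::int \<Rightarrow> 'v. \<forall>k. f (t k) (t (k + 1)) = t k \<and> g (t k) (t (k + 1)) = t (k + 1) \<and> t k \<noteq> z"
proof -
  obtain v0 where v0: "v0 \<noteq> z" using nontrivial by blast
  define T where "T u = (SOME b. f u b = u)" for u
  define U where "U u = (SOME a. g a u = u)" for u
  have T: "f u (T u) = u" for u unfolding T_def by (rule someI_ex[OF f_surj])
  have U: "g (U u) u = u" for u unfolding U_def by (rule someI_ex[OF g_surj])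
  have Tz: "T u \<noteq> z" if "u \<noteq> z" for u using that T[of u] fix_iff[of u "T u"] g_zero_iff by metis
  have Uz: "U u \<noteq> z" if "u \<noteq> z" for u using that U[of u] fix_iff[of "U u" u] f_zero_iff by metis
  define t where "t k = (if k \<ge> 0 then (T ^^ nat k) v0 else (U ^^ nat (- k)) v0)" for k :: int
  have "f (t k) (t (k + 1)) = t k" for k
  proof (cases "k \<ge> 0")
    case True
    then have "nat (k + 1) = Suc (nat k)" by simp
    then show ?thesis using True T by (simp add: t_def)
  next
    case False
    then have "nat (- k) = Suc (nat (- (k + 1)))" by simp
    then have "t k = U (t (k + 1))" using False by (cases "k = - 1") (auto simp: t_def)
    then show ?thesis using U fix_iff by metis
  qed
  moreover have "(T ^^ n) v0 \<noteq> z" "(U ^^ n) v0 \<noteq> z" for n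
    by (induction n) (use v0 Tz Uz in auto)
  then have "t k \<noteq> z" for k by (simp add: t_def)
  ultimately show ?thesis using fix_iff by metis
qed

lemma gd_classical_colourable:
  assumes cl: "gd_classical (L, s)" and "L \<noteq> []"
  shows "colourable (L, s)"
proof -
  have wf: "gd_wf (L, s)" using cl by (simp add: gd_classical_def)
  have dist: "distinct (concat L)" by (rule gd_wf_distinct[OF wf])
  obtain H where H: "\<And>d. d \<in> gd_darts L \<Longrightarrow> H (gd_rot s d) = (H (gd_alpha L d) :: int)"
    "\<And>d. d \<in> gd_darts L \<Longrightarrow> H (gd_rot s d) = H d + (if snd (snd d) then 1 else - 1)"
    using gd_classical_potential[OF cl] by blast
  obtain t where t: "f (t k) (t (k + 1)) = t k" "g (t k) (t (k + 1)) = t (k + 1)" "t k \<noteq> z" for k :: int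
    using fixed_sequence by blast
  \<comment> \<open>A semi-arc gets the number of the face to the right of its initial dart.\<close>
  define j where "j e = t (H (fst e, snd e, True))" for e :: gentry
  define i where "i e = j (gd_pred L e)" for e
  have i: "i (x, ov) = t (H (gd_rot s (x, ov, False)))" if "x \<in> gd_crossings L" for x ov
    using H(1)[of "(x, ov, False)"] that by (simp add: i_def j_def gd_darts_def gd_alpha_def)
  have "coloured_at s i j x" if x: "x \<in> gd_crossings L" for x
  proof -
    \<comment> \<open>Over-output and under-input both have number \<open>w\<close>; the other two
      semi-arcs have \<open>w + 1\<close> at a positive crossing and \<open>w - 1\<close> at a
      negative one. Either way S is applied to consecutive terms of \<open>t\<close>.\<close>
    define w where "w = H (x, True, True)"
    have h: "H (gd_rot s (x, ov, out)) = H (x, ov, out) + (if out then 1 else - 1)" for ov out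
      using H(2)[of "(x, ov, out)"] x by (simp add: gd_darts_def)
    show ?thesis
    proof (cases "s x")
      case True
      note r = gd_rot_simps(1-4)[of s, OF True]
      have "H (x, False, True) = w + 1" "H (x, False, False) = w + 1"
        using h[of True True] h[of False False] by (simp_all add: r w_def)
      then show ?thesis using t(1,2)[of w] True i[OF x]
        by (simp add: coloured_at_def r) (simp add: j_def w_def)
    next
      case False
      note r = gd_rot_simps(5-8)[of s, OF False]
      have "H (x, False, True) = w - 1" "H (x, True, False) = w"
        using h[of True False] h[of False True] by (simp_all add: r w_def)
      then show ?thesis using t(1,2)[of "w - 1"] False i[OF x]
        by (simp add: coloured_at_def r) (simp add: j_def w_def)
    qed
  qed
  moreover have "\<exists>p. flow i j p w p" if "w \<in> set L" for w
    by (rule closed_flowI) (simp add: i_def gd_pred_nth[OF dist that])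
  moreover have "[] \<in> set L \<or> (\<exists>e\<in>set (concat L). j e \<noteq> z)"
  proof (cases "[] \<in> set L")
    case False
    then obtain e where "e \<in> set (concat L)"
      using \<open>L \<noteq> []\<close> by (metis concat_eq_Nil_conv last_in_set)
    moreover have "j e \<noteq> z" using t(3) by (simp add: j_def)
    ultimately show ?thesis by blast
  qed simp
  ultimately show ?thesis unfolding colourable_def fst_conv snd_conv by blast
qed

text \<open>Passes from entry and exit labels to one label per semi-arc. As no circle is empty, the
  nonzero label sits on an actual semi-arc, as a kernel vector requires.\<close>

lemma classical_link_colouring:
  assumes "represents_classical_link (L, s)" "gd_wf (L, s)" "L \<noteq> []" "[] \<notin> set L"
  shows "\<exists>j. (\<forall>x\<in>gd_crossings L. coloured_at s (\<lambda>e. j (gd_pred L e)) j x) \<and>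
             (\<exists>e\<in>set (concat L). j e \<noteq> z)"
proof -
  obtain D0 where D0: "gd_classical D0" "gd_equiv (L, s) D0"
    using assms(1) unfolding represents_classical_link_def by blast
  have "fst D0 \<noteq> []" using gd_equiv_length[OF D0(2)] assms(3) by auto
  then have "colourable D0" using gd_classical_colourable[of "fst D0" "snd D0"] D0(1) by simp
  then have "colourable (L, s)" using gd_equiv_colourable[OF D0(2)] by blast
  then obtain i j where ij: "\<And>x. x \<in> gd_crossings L \<Longrightarrow> coloured_at s i j x"
      "\<And>w. w \<in> set L \<Longrightarrow> \<exists>p. flow i j p w p" "\<exists>e\<in>set (concat L). j e \<noteq> z"
    using assms(4) unfolding colourable_def fst_conv snd_conv by blast
  have dist: "distinct (concat L)" by (rule gd_wf_distinct[OF assms(2)])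
  have pred: "i e = j (gd_pred L e)" if e: "e \<in> set (concat L)" for e
  proof -
    obtain w k where w: "w \<in> set L" "k < length w" "e = w ! k"
      using entry_position[OF e] .
    obtain p where "flow i j p w p" using ij(2)[OF w(1)] by blast
    from closed_flow_pred[OF this w(2)] show ?thesis using gd_pred_nth[OF dist w(1,2)] w(3) by simp
  qed
  have "coloured_at s (\<lambda>e. j (gd_pred L e)) j x" if "x \<in> gd_crossings L" for x
  proof -
    have "(x, True) \<in> set (concat L)" "(x, False) \<in> set (concat L)"
      unfolding gd_wf_entries[OF assms(2)] using that by simp_all
    then show ?thesis using ij(1)[OF that] pred unfolding coloured_at_def by simp
  qed
  with ij(3) show ?thesis by blast
qed

end

section \<open>The presentation matrix\<close>

lemma sqrt_ac_square: "sqrt_ac x * sqrt_ac x = x"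
proof -
  have "\<exists>r. r ^ 2 = x" by (rule nth_root_exists) simp
  from someI_ex[OF this] show ?thesis by (simp add: sqrt_ac_def power2_eq_square)
qed

lemma qemb_additive:
  "qemb lam mu (qadd x y) r c = qemb lam mu x r c + qemb lam mu y r c"
  "qemb lam mu (qneg x) r c = - qemb lam mu x r c"
  "qemb lam mu (qsub x y) r c = qemb lam mu x r c - qemb lam mu y r c"
  "qemb lam mu qzero r c = 0"
  by (cases x; cases y; simp add: qsub_def qzero_def Let_def algebra_simps)+

lemma qemb_mul:
  "qemb lam mu (qmul lam mu x y) r c =
     qemb lam mu x r 0 * qemb lam mu y 0 c + qemb lam mu x r 1 * qemb lam mu y 1 c"
proof -
  define s where "s = sqrt_ac (- to_ac lam)"
  define t where "t = sqrt_ac (to_ac mu)"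
  have s: "s * s = - to_ac lam" "s * (s * u) = - to_ac lam * u" for u
    using sqrt_ac_square[of "- to_ac lam"] by (simp_all add: s_def mult.assoc[symmetric])
  have t: "t * t = to_ac mu" "t * (t * u) = to_ac mu * u" for u
    using sqrt_ac_square[of "to_ac mu"] by (simp_all add: t_def mult.assoc[symmetric])
  \<comment> \<open>Normal order with \<open>s\<close> before \<open>t\<close>, so that equal roots
    meet and their squares reduce.\<close>
  have st: "t * (s * u) = s * (t * u)" "t * s = s * t" for u by (simp_all add: ac_simps)
  show ?thesis
    by (cases x; cases y; cases "r = 0"; cases "c = 0")
      (simp_all add: Let_def s_def[symmetric] t_def[symmetric] algebra_simps s t st)
qed

text \<open>Combining the two diagonal entries isolates \<open>2 a0\<close>, combining the other two
  isolates \<open>2 a1 s\<close>. Characteristic other than 2 removes the factor 2, and the roots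
  are nonzero because \<open>lam\<close> and \<open>mu\<close> are.\<close>

lemma qemb_eq_0:
  fixes lam mu :: "'a::field"
  assumes "(2::'a) \<noteq> 0" "lam \<noteq> 0" "mu \<noteq> 0" and z: "\<And>r c. qemb lam mu x r c = 0"
  shows "x = qzero"
proof -
  obtain a0 a1 a2 a3 where x: "x = Quat a0 a1 a2 a3" by (cases x)
  define s where "s = sqrt_ac (- to_ac lam)"
  define t where "t = sqrt_ac (to_ac mu)"
  have s: "s \<noteq> 0" "t \<noteq> 0"
    using sqrt_ac_square[of "- to_ac lam"] sqrt_ac_square[of "to_ac mu"] assms(2,3)
    by (auto simp: s_def[symmetric] t_def[symmetric])
  have two: "(2::'a alg_closure) \<noteq> 0"
    using assms(1) by (metis to_ac_numeral to_ac_eq_0_iff)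
  have e: "to_ac a0 + to_ac a3 * (s * t) = 0" "to_ac a0 - to_ac a3 * (s * t) = 0"
    "to_ac a1 * s + to_ac a2 * t = 0" "- (to_ac a1 * s) + to_ac a2 * t = 0"
    using z[of 0 0] z[of 1 1] z[of 0 1] z[of 1 0] by (simp_all add: x s_def t_def Let_def)
  have half: "u = 0" if "u + v = 0" "u - v = 0 \<or> - u + v = 0" for u v :: "'a alg_closure"
  proof -
    have "2 * u = 0" using that by (auto simp: algebra_simps mult_2)
    then show ?thesis using two by simp
  qed
  have "to_ac a0 = 0" "to_ac a1 * s = 0" using half e by blast+
  then show ?thesis using e s by (auto simp: x qzero_def)
qed

lemma sum_lessThan_double: "(\<Sum>k<2 * m. h k) = (\<Sum>j<m. h (2 * j) + h (2 * j + 1 :: nat))"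
  by (induction m) (simp_all add: ac_simps)

text \<open>A column of quaternions becomes two ordinary columns. Each lies in the kernel of the
  embedded matrix, and since the embedding is injective one of them is nonzero.\<close>

lemma qdet_eq_0:
  fixes lam mu :: "'a::field"
  assumes "(2::'a) \<noteq> 0" "lam \<noteq> 0" "mu \<noteq> 0"
    and j: "j < m" "x j \<noteq> qzero"
    and ker: "\<And>i r c. i < m \<Longrightarrow>
      (\<Sum>j<m. qemb lam mu (qmul lam mu (M i j) (x j)) r c) = 0"
  shows "qdet lam mu m M = 0"
proof -
  obtain r c where rc: "qemb lam mu (x j) r c \<noteq> 0" using qemb_eq_0[OF assms(1-3)] j(2) by blast
  define v where "v = vec (2 * m) (\<lambda>k. qemb lam mu (x (k div 2)) (k mod 2) c)"
  define N where "N = mat (2 * m) (2 * m)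
    (\<lambda>(r, c). qemb lam mu (M (r div 2) (c div 2)) (r mod 2) (c mod 2))"
  have row: "(\<Sum>k<2 * m. N $$ (i, k) * v $ k) = 0" if "i < 2 * m" for i
  proof -
    have "(\<Sum>k<2 * m. N $$ (i, k) * v $ k) =
        (\<Sum>j<m. qemb lam mu (qmul lam mu (M (i div 2) j) (x j)) (i mod 2) c)"
      unfolding sum_lessThan_double qemb_mul
      by (rule sum.cong) (use that in \<open>auto simp: N_def v_def\<close>)
    also have "\<dots> = 0" using that by (intro ker) auto
    finally show ?thesis .
  qed
  have "N *\<^sub>v v = 0\<^sub>v (2 * m)"
    using row by (intro eq_vecI) (auto simp: N_def v_def scalar_prod_def lessThan_atLeast0)
  moreover have "v \<noteq> 0\<^sub>v (2 * m)"
  proof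
    assume v0: "v = 0\<^sub>v (2 * m)"
    \<comment> \<open>\<open>qemb\<close> reads every nonzero index as 1, so \<open>r\<close> is
      first brought down to 0 or 1.\<close>
    define k where "k = 2 * j + (if r = 0 then 0 else 1)"
    have "k < 2 * m" using j(1) by (simp add: k_def)
    then have "v $ k = 0" using v0 by simp
    moreover have "qemb lam mu (x j) r c = qemb lam mu (x j) (if r = 0 then 0 else 1) c"
      by (cases "x j") (simp add: Let_def)
    then have "v $ k = qemb lam mu (x j) r c"
      using j(1) by (auto simp: v_def k_def)
    ultimately have "qemb lam mu (x j) r c = 0" by simp
    with rc show False by simp
  qed
  moreover have "v \<in> carrier_vec (2 * m)" "N \<in> carrier_mat (2 * m) (2 * m)"
    by (simp_all add: v_def N_def)
  ultimately show ?thesis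
    unfolding qdet_def N_def[symmetric] using det_0_iff_vec_prod_zero_field by blast
qed


text \<open>The product depends on the parameters \<open>lam\<close> and \<open>mu\<close>, so the
  ring structure is given by the class predicate and interpreted where required.\<close>

lemma quat_ring: "class.ring_1 qone (qmul lam mu) qadd qzero qsub qneg"
proof
  fix a b c :: "'a quat"
  show "qmul lam mu (qmul lam mu a b) c = qmul lam mu a (qmul lam mu b c)"
    by (cases a; cases b; cases c) (simp add: algebra_simps)
  show "qadd (qadd a b) c = qadd a (qadd b c)" "qadd a b = qadd b a"
    by (cases a; cases b; cases c; simp)+
  show "qmul lam mu (qadd a b) c = qadd (qmul lam mu a c) (qmul lam mu b c)"
    "qmul lam mu c (qadd a b) = qadd (qmul lam mu c a) (qmul lam mu c b)"
    by (cases a; cases b; cases c; simp add: algebra_simps)+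
  show "qadd qzero a = a" "qmul lam mu qone a = a" "qmul lam mu a qone = a" "qadd (qneg a) a = qzero"
    by (cases a; simp add: qzero_def qone_def)+
  show "qsub a b = qadd a (qneg b)" by (simp add: qsub_def)
  show "qzero \<noteq> (qone :: 'a quat)" by (simp add: qzero_def qone_def)
qed

lemma nc_switch_imp_switch:
  assumes "nc_switch lam mu A B C D"
  shows "switch (\<lambda>a b. qadd (qmul lam mu A a) (qmul lam mu B b))
    (\<lambda>a b. qadd (qmul lam mu C a) (qmul lam mu D b)) qzero"
proof -
  have inv: "qmul lam mu x (qinv lam mu x) = qone" "qmul lam mu (qinv lam mu x) x = qone"
    if "qinvertible lam mu x" for x
    using someI_ex[OF that[unfolded qinvertible_def]] unfolding qinv_def by blast+
  show ?thesis
    using assms unfolding nc_switch_def Let_def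
    by (elim conjE) (rule ring_1.nc_switch_switch[OF quat_ring inv inv inv])
qed


text \<open>Evaluates one row of the presentation matrix. The indicators are combined additively, so
  the formula also covers coinciding semi-arcs, as at a kink.\<close>

lemma qind_row_sum:
  fixes m :: nat
  assumes "a < m" "b < m" "c < m"
  shows "(\<Sum>k<m. qemb lam mu (qmul lam mu
      (qsub (qsub (qind (k = c) qone) (qind (k = a) P)) (qind (k = b) Q)) (x k)) r q) =
    qemb lam mu (qsub (qsub (x c) (qmul lam mu P (x a))) (qmul lam mu Q (x b))) r q"
proof -
  interpret Q: Rings.ring_1 qone "qmul lam mu" qadd qzero qsub qneg by (rule quat_ring)
  have ind: "qmul lam mu (qind R u) v = qind R (qmul lam mu u v)"
    "qemb lam mu (qind R u) r q = (if R then qemb lam mu u r q else 0)" for R u v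
    by (simp_all add: qind_def qemb_additive)
  have "qemb lam mu (qmul lam mu
      (qsub (qsub (qind (k = c) qone) (qind (k = a) P)) (qind (k = b) Q)) (x k)) r q =
      (if k = c then qemb lam mu (x k) r q else 0)
      - (if k = a then qemb lam mu (qmul lam mu P (x k)) r q else 0)
      - (if k = b then qemb lam mu (qmul lam mu Q (x k)) r q else 0)" for k
    unfolding Q.left_diff_distrib qemb_additive ind by simp
  then show ?thesis using assms by (simp add: sum_subtractf qemb_additive)
qed

theorem theorem9p3:
  fixes lam mu :: "'a::field" and A B C D :: "'a quat"
    and L :: "gentry list list" and s :: "nat \<Rightarrow> bool" and n :: nat
  assumes "(2::'a) \<noteq> 0" and "lam \<noteq> 0" and "mu \<noteq> 0"
    and "nc_switch lam mu A B C D"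
    and "gd_wf (L, s)" and "gd_crossings L = {0..<n}" and "1 \<le> n" and "[] \<notin> set L"
    and "represents_classical_link (L, s)"
  shows "Delta0 lam mu A B C D n (L, s) = 0"
proof -
  interpret S: switch "\<lambda>a b. qadd (qmul lam mu A a) (qmul lam mu B b)"
    "\<lambda>a b. qadd (qmul lam mu C a) (qmul lam mu D b)" qzero
    by (rule nc_switch_imp_switch) fact
  interpret Q: Rings.ring_1 qone "qmul lam mu" qadd qzero qsub qneg by (rule quat_ring)
  have "L \<noteq> []" using assms(6,7) by (auto simp: gd_crossings_def)
  then obtain j where col: "\<forall>y\<in>{0..<n}. S.coloured_at s (\<lambda>e. j (gd_pred L e)) j y"
    and "\<exists>e\<in>set (concat L). j e \<noteq> qzero"
    using S.classical_link_colouring[OF assms(9,5) _ assms(8)] unfolding assms(6) by blast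
  then obtain e0 where e0: "e0 \<in> set (concat L)" "j e0 \<noteq> qzero" by blast
  have j: "S.coloured_at s (\<lambda>e. j (gd_pred L e)) j y" if "y < n" for y using col that by simp
  have dist: "distinct (concat L)" by (rule gd_wf_distinct) fact
  have semiarc_less: "semiarc e < 2 * n" if "e \<in> set (concat L)" for e
  proof -
    have "fst e \<in> gd_crossings L" using that unfolding gd_crossings_def by blast
    then show ?thesis using assms(6) by (auto simp: semiarc_def)
  qed
  \<comment> \<open>Inverts the numbering \<open>semiarc\<close>: the parity of an index tells over
    from under.\<close>
  define x where "x k = j (k div 2, odd k)" for k
  have x: "x (semiarc e) = j e" for e by (cases e) (simp add: x_def semiarc_def)
  show ?thesis
    unfolding Delta0_def
  proof (rule qdet_eq_0[OF assms(1-3), of "semiarc e0" _ x])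
    show "semiarc e0 < 2 * n" "x (semiarc e0) \<noteq> qzero" using semiarc_less e0 by (simp_all add: x)
  next
    fix i r q assume "i < 2 * n"
    then have y: "i div 2 < n" by simp
    obtain a b c d where l: "xlabels (L, s) (i div 2) = (a, b, c, d)" by (metis prod_cases4)
    have e: "(i div 2, ov) \<in> set (concat L)" for ov
      unfolding gd_wf_entries[OF assms(5)] using y assms(6) by simp
    have lt: "semiarc (i div 2, ov) < 2 * n" "semiarc (gd_pred L (i div 2, ov)) < 2 * n" for ov
      by (rule semiarc_less, rule e, rule semiarc_less, rule gd_succ_pred(2)[OF dist e])
    have less: "a < 2 * n" "b < 2 * n" "c < 2 * n" "d < 2 * n"
      using l lt by (auto simp: xlabels_def split: if_splits)
    \<comment> \<open>At a negative crossing \<open>xlabels\<close> and \<open>crossing\<close> both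
      exchange inputs with outputs, so the relations read the same for either sign.\<close>
    have col: "x c = qadd (qmul lam mu A (x a)) (qmul lam mu B (x b))"
      "x d = qadd (qmul lam mu C (x a)) (qmul lam mu D (x b))"
      using j[OF y] l unfolding S.coloured_at_def S.crossing_def
      by (auto simp: xlabels_def x split: if_splits)
    have "qsub (qsub (qadd u v) u) v = qzero" for u v :: "'a quat" by simp
    then show "(\<Sum>k<2 * n. qemb lam mu (qmul lam mu (pres_matrix A B C D (L, s) i k) (x k)) r q) = 0"
      using qind_row_sum[OF less(1,2,3), of lam mu A B x r q] qind_row_sum[OF less(1,2,4), of lam mu C D x r q]
      by (cases "i mod 2 = 0") (simp_all add: pres_matrix_def l col qemb_additive)
  qed
qed

end
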